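(* Let $\mathcal{H}$ be a finite-dimensional Hilbert space and let $\mathscr{A}\subseteq\mathfrak{B}(\mathcal{H})$ be a unital $*$-subalgebra with Wedderburn decomposition $\mathscr{A}=U\big(\bigoplus_{k}\mathfrak{B}(\mathcal{H}_{F,k})\otimes\mathbb{1}_{G,k}\big)U^\dagger$, and let $\check{\mathscr{A}}=\bigoplus_k\mathfrak{B}(\mathcal{H}_{F,k})$. For a choice of full-rank density operators $\tau_k$ on $\mathcal{H}_{G,k}$, let $\mathcal{R}:\mathfrak{B}(\mathcal{H})\to\check{\mathscr{A}}$ and $\mathcal{J}:\check{\mathscr{A}}\to\mathfrak{B}(\mathcal{H})$ be the CPTP maps $$\mathcal{R}(X)=\bigoplus_k \mathrm{tr}_{\mathcal{H}_{G,k}}(W_kXW_k^\dagger),\qquad \mathcal{J}\Big(\bigoplus_k X_k\Big)=U\Big(\bigoplus_k X_k\otimes\tau_k\Big)U^\dagger,$$ so that $\mathcal{J}\mathcal{R}$ is the state extension (dual of the conditional expectation) onto $\mathscr{A}$ associated with the $\tau_k$. Then for every Lindblad generator $\mathcal{L}$ on $\mathfrak{B}(\mathcal{H})$, the reduced map $\check{\mathcal{L}}\equiv\mathcal{R}\mathcal{L}\mathcal{J}$ is again a Lindblad generator: $\check{\mathcal{L}}$ maps $\check{\mathscr{A}}$ into $\check{\mathscr{A}}$ and $\{e^{\check{\mathcal{L}}t}\}_{t\ge0}$ is a quantum dynamical semigroup (a continuous one-parameter semigroup of completely positive trace-preserving maps) on $\check{\mathscr{A}}$.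
   Context: A Lindblad generator on $\mathfrak{B}(\mathcal{H})$ is a linear map of the form $\mathcal{L}(\rho)=-i[H,\rho]+\sum_u\big(L_u\rho L_u^\dagger-\tfrac12\{L_u^\dagger L_u,\rho\}\big)$ with $H=H^\dagger$ and arbitrary operators $L_u$. Wedderburn decomposition: $U$ is a unitary on $\mathcal{H}$ with $\mathcal{H}\cong U\big(\bigoplus_k\mathcal{H}_{F,k}\otimes\mathcal{H}_{G,k}\big)$. $W_k=P_kU^\dagger$, where $P_k$ is the co-isometry from $\bigoplus_j\mathcal{H}_{F,j}\otimes\mathcal{H}_{G,j}$ onto its $k$-th summand, so $W_kW_k^\dagger=\mathbb{1}_{F,k}\otimes\mathbb{1}_{G,k}$. $\check{\mathscr{A}}$ is the algebra of block-diagonal operators on $\bigoplus_k\mathcal{H}_{F,k}$. *)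

theory Defs
  imports Complex_Main "Jordan_Normal_Form.Matrix"
begin

definition adj :: "complex mat \<Rightarrow> complex mat" where
  "adj A = mat (dim_col A) (dim_row A) (\<lambda>(i,j). cnj (A $$ (j,i)))"

definition hermitian_mat :: "complex mat \<Rightarrow> bool" where
  "hermitian_mat A \<longleftrightarrow> adj A = A"

definition unitary_mat :: "nat \<Rightarrow> complex mat \<Rightarrow> bool" where
  "unitary_mat n U \<longleftrightarrow> U \<in> carrier_mat n n \<and> U * adj U = 1\<^sub>m n \<and> adj U * U = 1\<^sub>m n"

definition commutator :: "complex mat \<Rightarrow> complex mat \<Rightarrow> complex mat" where
  "commutator A B = A * B - B * A"

definition anticommutator :: "complex mat \<Rightarrow> complex mat \<Rightarrow> complex mat" where
  "anticommutator A B = A * B + B * A"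

definition mtrace :: "complex mat \<Rightarrow> complex" where
  "mtrace A = (\<Sum>i<dim_row A. A $$ (i,i))"

definition psd :: "nat \<Rightarrow> complex mat \<Rightarrow> bool" where
  "psd d A \<longleftrightarrow> A \<in> carrier_mat d d \<and>
     (\<forall>v \<in> carrier_vec d. \<exists>r::real. r \<ge> 0 \<and>
        (\<Sum>i<d. cnj (v $ i) * (A *\<^sub>v v) $ i) = complex_of_real r)"

definition full_rank_density :: "nat \<Rightarrow> complex mat \<Rightarrow> bool" where
  "full_rank_density d A \<longleftrightarrow> psd d A \<and> (\<exists>B \<in> carrier_mat d d. A * B = 1\<^sub>m d \<and> B * A = 1\<^sub>m d)
      \<and> mtrace A = 1"

definition lindblad_generator :: "nat \<Rightarrow> (complex mat \<Rightarrow> complex mat) \<Rightarrow> bool" where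
  "lindblad_generator d \<L> \<longleftrightarrow>
     (\<exists>H Ls. H \<in> carrier_mat d d \<and> hermitian_mat H \<and> set Ls \<subseteq> carrier_mat d d \<and>
        (\<forall>\<rho> \<in> carrier_mat d d.
           \<L> \<rho> = (- \<i>) \<cdot>\<^sub>m commutator H \<rho> +
             foldr (\<lambda>Lu acc. (Lu * \<rho> * adj Lu - (1/2) \<cdot>\<^sub>m anticommutator (adj Lu * Lu) \<rho>) + acc)
               Ls (0\<^sub>m d d)))"

definition kron :: "complex mat \<Rightarrow> complex mat \<Rightarrow> complex mat" where
  "kron A B = mat (dim_row A * dim_row B) (dim_col A * dim_col B)
     (\<lambda>(i,j). A $$ (i div dim_row B, j div dim_col B) * B $$ (i mod dim_row B, j mod dim_col B))"

definition ptrace2 :: "nat \<Rightarrow> nat \<Rightarrow> complex mat \<Rightarrow> complex mat" where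
  "ptrace2 f g M = mat f f (\<lambda>(i,j). \<Sum>l<g. M $$ (i * g + l, j * g + l))"

fun bdiag :: "complex mat list \<Rightarrow> complex mat" where
  "bdiag [] = 0\<^sub>m 0 0"
| "bdiag (M # Ms) = four_block_mat M (0\<^sub>m (dim_row M) (dim_col (bdiag Ms)))
                      (0\<^sub>m (dim_row (bdiag Ms)) (dim_col M)) (bdiag Ms)"

definition offset :: "nat list \<Rightarrow> nat \<Rightarrow> nat" where
  "offset ds k = sum_list (take k ds)"

definition diag_block :: "nat \<Rightarrow> nat \<Rightarrow> complex mat \<Rightarrow> complex mat" where
  "diag_block off s M = mat s s (\<lambda>(i,j). M $$ (off + i, off + j))"

text \<open>The Wedderburn decomposition is given by a list bl of pairs (f_k, g_k) =
  (dim H_{F,k}, dim H_{G,k}) and a unitary U on C^n, n = sum_k f_k g_k.\<close>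

definition fdims :: "(nat \<times> nat) list \<Rightarrow> nat list" where
  "fdims bl = map fst bl"

definition fgdims :: "(nat \<times> nat) list \<Rightarrow> nat list" where
  "fgdims bl = map (\<lambda>(f,g). f * g) bl"

definition Pk :: "(nat \<times> nat) list \<Rightarrow> nat \<Rightarrow> complex mat" where
  "Pk bl k = mat (fgdims bl ! k) (sum_list (fgdims bl))
      (\<lambda>(i,j). if j = offset (fgdims bl) k + i then 1 else 0)"

definition Wk :: "(nat \<times> nat) list \<Rightarrow> complex mat \<Rightarrow> nat \<Rightarrow> complex mat" where
  "Wk bl U k = Pk bl k * adj U"

definition red_alg :: "(nat \<times> nat) list \<Rightarrow> complex mat set" where
  "red_alg bl = {bdiag Xs | Xs. length Xs = length bl \<and>
                   (\<forall>k < length bl. Xs ! k \<in> carrier_mat (fst (bl ! k)) (fst (bl ! k)))}"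

definition red_R :: "(nat \<times> nat) list \<Rightarrow> complex mat \<Rightarrow> complex mat \<Rightarrow> complex mat" where
  "red_R bl U X = bdiag (map (\<lambda>k. ptrace2 (fst (bl ! k)) (snd (bl ! k))
                                       (Wk bl U k * X * adj (Wk bl U k))) [0..<length bl])"

definition red_J :: "(nat \<times> nat) list \<Rightarrow> complex mat \<Rightarrow> (nat \<Rightarrow> complex mat) \<Rightarrow> complex mat \<Rightarrow> complex mat" where
  "red_J bl U \<tau> X = U * bdiag (map (\<lambda>k. kron (diag_block (offset (fdims bl) k) (fst (bl ! k)) X) (\<tau> k))
                                   [0..<length bl]) * adj U"

definition map_exp :: "nat \<Rightarrow> (complex mat \<Rightarrow> complex mat) \<Rightarrow> real \<Rightarrow> complex mat \<Rightarrow> complex mat" where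
  "map_exp d \<L> t X = mat d d (\<lambda>(i,j). \<Sum>n. complex_of_real (t ^ n / fact n) * ((\<L> ^^ n) X) $$ (i,j))"

definition block_mat :: "nat \<Rightarrow> nat \<Rightarrow> (nat \<Rightarrow> nat \<Rightarrow> complex mat) \<Rightarrow> complex mat" where
  "block_mat m d X = mat (m * d) (m * d) (\<lambda>(a,b). X (a div d) (b div d) $$ (a mod d, b mod d))"

text \<open>Complete positivity of \<Phi> on a *-subalgebra A of B(C^d): for every m,
  \<Phi> \<otimes> id_m maps positive elements of A \<otimes> M_m (= M_m(A)) to positive elements.\<close>
definition completely_positive_on :: "nat \<Rightarrow> complex mat set \<Rightarrow> (complex mat \<Rightarrow> complex mat) \<Rightarrow> bool" where
  "completely_positive_on d A \<Phi> \<longleftrightarrow>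
     (\<forall>m X. (\<forall>i<m. \<forall>j<m. X i j \<in> A) \<longrightarrow> psd (m * d) (block_mat m d X) \<longrightarrow>
        psd (m * d) (block_mat m d (\<lambda>i j. \<Phi> (X i j))))"

definition linear_on :: "complex mat set \<Rightarrow> (complex mat \<Rightarrow> complex mat) \<Rightarrow> bool" where
  "linear_on A \<Phi> \<longleftrightarrow> (\<forall>X\<in>A. \<forall>Y\<in>A. \<forall>c. \<Phi> (c \<cdot>\<^sub>m X + Y) = c \<cdot>\<^sub>m \<Phi> X + \<Phi> Y)"

definition cptp_on :: "nat \<Rightarrow> complex mat set \<Rightarrow> (complex mat \<Rightarrow> complex mat) \<Rightarrow> bool" where
  "cptp_on d A \<Phi> \<longleftrightarrow> (\<forall>X\<in>A. \<Phi> X \<in> A) \<and> linear_on A \<Phi> \<and> completely_positive_on d A \<Phi>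
      \<and> (\<forall>X\<in>A. mtrace (\<Phi> X) = mtrace X)"

definition qds_on :: "nat \<Rightarrow> complex mat set \<Rightarrow> (real \<Rightarrow> complex mat \<Rightarrow> complex mat) \<Rightarrow> bool" where
  "qds_on d A T \<longleftrightarrow>
     (\<forall>t\<ge>0. cptp_on d A (T t)) \<and>
     (\<forall>X\<in>A. T 0 X = X) \<and>
     (\<forall>s\<ge>0. \<forall>t\<ge>0. \<forall>X\<in>A. T (s + t) X = T s (T t X)) \<and>
     (\<forall>X\<in>A. \<forall>i<d. \<forall>j<d. continuous_on {0..} (\<lambda>t. T t X $$ (i,j)))"

end

theory Submission
  imports "HOL-Analysis.Uniform_Limit" "HOL-Library.Nonpos_Ints" Defs
begin

text \<open>
  Write the generator as \<open>\<L>(\<rho>) = \<Psi>(\<rho>) + G\<rho> + \<rho>G\<^sup>*\<close> with \<open>\<Psi>\<close> completely positive. Then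
  \<open>N\<^sub>\<epsilon>(\<rho>) = (1 + \<epsilon>G)\<rho>(1 + \<epsilon>G)\<^sup>* + \<epsilon>\<Psi>(\<rho>) = \<rho> + \<epsilon>\<L>(\<rho>) + \<epsilon>\<^sup>2G\<rho>G\<^sup>*\<close> is completely positive, and as \<open>\<R>\<J>\<close> is
  the identity on the reduced algebra, \<open>M\<^sub>\<epsilon> = \<R>N\<^sub>\<epsilon>\<J>\<close> is a completely positive map of the form
  \<open>id + \<epsilon>(\<R>\<L>\<J> + \<epsilon>Q)\<close> there. Hence \<open>exp(t(\<R>\<L>\<J> + \<epsilon>Q)) = exp(-t/\<epsilon>) exp((t/\<epsilon>)M\<^sub>\<epsilon>)\<close> is completely
  positive, and \<open>\<epsilon> \<rightarrow> 0\<close> gives complete positivity of \<open>exp(t\<R>\<L>\<J>)\<close>. No structure theorem for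
  generators on the reduced algebra is needed.
\<close>

unbundle no vec_syntax

section \<open>Completely positive maps between matrix spaces\<close>

text \<open>The obstacle is that the reduced algebra is only a subspace of the matrix space its
  elements live in: \<open>red_R\<close> after \<open>red_J\<close> is the identity on it, but
  erases off-diagonal blocks elsewhere. All maps are therefore linear on the full matrix space,
  while the identities between them are used only on an invariant subset. That subset is described
  as the fixed points of a linear map, which makes it stable under linear combinations and entrywise
  limits. The plain Euler step \<open>\<rho> + \<epsilon> \<L>(\<rho>)\<close> need not be
  completely positive, because \<open>G\<rho> + \<rho>G*\<close> alone is not. Completing it to
  conjugation by \<open>1 + \<epsilon>G\<close> costs the second-order term. That term is not
  estimated away but kept exactly, as a perturbation \<open>\<epsilon>Q\<close> of the generator, so
  each approximant is a genuine exponential and only continuity of the exponential in the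
  perturbation remains to be shown. Entrywise bounds \<open>C ^ k * B\<close> on iterates, uniform
  in \<epsilon>, supply the majorants for that limit.\<close>

definition lin_map :: "nat \<Rightarrow> nat \<Rightarrow> (complex mat \<Rightarrow> complex mat) \<Rightarrow> bool" where
  "lin_map d d' \<Phi> \<longleftrightarrow> (\<forall>X\<in>carrier_mat d d. \<Phi> X \<in> carrier_mat d' d') \<and> linear_on (carrier_mat d d) \<Phi>"

lemma lin_mapI:
  assumes "\<And>X. X \<in> carrier_mat d d \<Longrightarrow> \<Phi> X \<in> carrier_mat d' d'"
    and "\<And>X Y c. X \<in> carrier_mat d d \<Longrightarrow> Y \<in> carrier_mat d d \<Longrightarrow> \<Phi> (c \<cdot>\<^sub>m X + Y) = c \<cdot>\<^sub>m \<Phi> X + \<Phi> Y"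
  shows "lin_map d d' \<Phi>"
  using assms by (auto simp: lin_map_def linear_on_def)

lemma lin_map_carrier: "lin_map d d' \<Phi> \<Longrightarrow> X \<in> carrier_mat d d \<Longrightarrow> \<Phi> X \<in> carrier_mat d' d'"
  by (simp add: lin_map_def)

lemma lin_map_lin:
  "lin_map d d' \<Phi> \<Longrightarrow> X \<in> carrier_mat d d \<Longrightarrow> Y \<in> carrier_mat d d \<Longrightarrow>
     \<Phi> (c \<cdot>\<^sub>m X + Y) = c \<cdot>\<^sub>m \<Phi> X + \<Phi> Y"
  by (simp add: lin_map_def linear_on_def)

lemma lin_map_comp: "lin_map d d' \<Phi> \<Longrightarrow> lin_map d' d'' \<Psi> \<Longrightarrow> lin_map d d'' (\<lambda>X. \<Psi> (\<Phi> X))"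
  unfolding lin_map_def linear_on_def by simp

lemma lin_map_add:
  assumes "lin_map d d' \<Phi>" "lin_map d d' \<Psi>"
  shows "lin_map d d' (\<lambda>X. \<Phi> X + \<Psi> X)"
proof (rule lin_mapI)
  fix X Y :: "complex mat" and c
  assume X: "X \<in> carrier_mat d d" and Y: "Y \<in> carrier_mat d d"
  note [simp] = lin_map_carrier[OF assms(1) X] lin_map_carrier[OF assms(1) Y]
    lin_map_carrier[OF assms(2) X] lin_map_carrier[OF assms(2) Y]
  have [simp]: "dim_row (\<Phi> X) = d'" "dim_row (\<Phi> Y) = d'" "dim_col (\<Phi> X) = d'" "dim_col (\<Phi> Y) = d'"
    "dim_row (\<Psi> X) = d'" "dim_row (\<Psi> Y) = d'" "dim_col (\<Psi> X) = d'" "dim_col (\<Psi> Y) = d'"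
    by (meson carrier_matD lin_map_carrier assms X Y)+
  show "\<Phi> (c \<cdot>\<^sub>m X + Y) + \<Psi> (c \<cdot>\<^sub>m X + Y) = c \<cdot>\<^sub>m (\<Phi> X + \<Psi> X) + (\<Phi> Y + \<Psi> Y)"
    by (intro eq_matI) (auto simp: lin_map_lin[OF assms(1) X Y] lin_map_lin[OF assms(2) X Y] algebra_simps)
qed (use assms in \<open>auto simp: lin_map_def\<close>)

lemma lin_map_smult:
  assumes "lin_map d d' \<Phi>"
  shows "lin_map d d' (\<lambda>X. c \<cdot>\<^sub>m \<Phi> X)"
proof (rule lin_mapI)
  fix X Y :: "complex mat" and b
  assume X: "X \<in> carrier_mat d d" and Y: "Y \<in> carrier_mat d d"
  have [simp]: "dim_row (\<Phi> X) = d'" "dim_row (\<Phi> Y) = d'" "dim_col (\<Phi> X) = d'" "dim_col (\<Phi> Y) = d'"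
    by (meson carrier_matD lin_map_carrier assms X Y)+
  show "c \<cdot>\<^sub>m \<Phi> (b \<cdot>\<^sub>m X + Y) = b \<cdot>\<^sub>m (c \<cdot>\<^sub>m \<Phi> X) + c \<cdot>\<^sub>m \<Phi> Y"
    by (intro eq_matI) (auto simp: lin_map_lin[OF assms(1) X Y] algebra_simps)
qed (use assms in \<open>auto simp: lin_map_def\<close>)

lemma lin_map_add_arg:
  assumes "lin_map d d' \<Phi>" "X \<in> carrier_mat d d" "Y \<in> carrier_mat d d"
  shows "\<Phi> (X + Y) = \<Phi> X + \<Phi> Y"
proof -
  have "1 \<cdot>\<^sub>m X = X" "1 \<cdot>\<^sub>m \<Phi> X = \<Phi> X" by auto
  then show ?thesis using lin_map_lin[OF assms, of 1] by simp
qed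

lemma lin_map_zero_arg:
  assumes "lin_map d d' \<Phi>"
  shows "\<Phi> (0\<^sub>m d d) = 0\<^sub>m d' d'"
proof -
  have c: "\<Phi> (0\<^sub>m d d) \<in> carrier_mat d' d'" using assms by (auto intro: lin_map_carrier)
  have eq: "\<Phi> (0\<^sub>m d d) = \<Phi> (0\<^sub>m d d) + \<Phi> (0\<^sub>m d d)"
    using lin_map_add_arg[OF assms, of "0\<^sub>m d d" "0\<^sub>m d d"] by simp
  show ?thesis
  proof (rule eq_matI)
    fix i j assume "i < dim_row (0\<^sub>m d' d' :: complex mat)" "j < dim_col (0\<^sub>m d' d' :: complex mat)"
    then have "\<Phi> (0\<^sub>m d d) $$ (i,j) = \<Phi> (0\<^sub>m d d) $$ (i,j) + \<Phi> (0\<^sub>m d d) $$ (i,j)"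
      using c arg_cong[OF eq, of "\<lambda>M. M $$ (i,j)"] by (metis carrier_matD index_add_mat(1) index_zero_mat(2,3))
    then show "\<Phi> (0\<^sub>m d d) $$ (i,j) = 0\<^sub>m d' d' $$ (i,j)"
      using \<open>i < _\<close> \<open>j < _\<close> by simp
  qed (use c in auto)
qed

lemma lin_map_smult_arg:
  assumes "lin_map d d' \<Phi>" "X \<in> carrier_mat d d"
  shows "\<Phi> (c \<cdot>\<^sub>m X) = c \<cdot>\<^sub>m \<Phi> X"
proof -
  have "\<Phi> X \<in> carrier_mat d' d'" using assms by (auto intro: lin_map_carrier)
  then show ?thesis
    using lin_map_lin[OF assms, of "0\<^sub>m d d" c] assms(2) by (simp add: lin_map_zero_arg[OF assms(1)])
qed

lemma lin_map_funpow:
  assumes "lin_map d d \<Phi>"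
  shows "lin_map d d (\<Phi> ^^ k)"
proof (induction k)
  case 0
  show ?case by (rule lin_mapI) auto
next
  case (Suc k)
  from lin_map_comp[OF this assms] show ?case by (simp add: o_def)
qed

text \<open>Expansion in matrix units: \<open>\<kappa> p i j\<close> is the entry
  \<open>(i,j)\<close> of the image of the unit at \<open>p\<close>. This finite formula is what
  gives linear maps a growth bound and lets them pass through series and limits.\<close>

lemma lin_map_entry:
  assumes \<Phi>: "lin_map d d' \<Phi>"
  shows "\<exists>\<kappa>. \<forall>X i j. X \<in> carrier_mat d d \<longrightarrow> i < d' \<longrightarrow> j < d' \<longrightarrow>
    \<Phi> X $$ (i,j) = (\<Sum>p\<in>{..<d}\<times>{..<d}. X $$ p * \<kappa> p i j)"
proof (intro exI allI impI)
  define E where "E p = mat d d (\<lambda>q. if q = p then 1 else (0::complex))" for p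
  fix X :: "complex mat" and i j assume X: "X \<in> carrier_mat d d" and ij: "i < d'" "j < d'"
  \<comment> \<open>Restricting \<open>X\<close> to an index set turns the expansion into an
    induction over finite sets of positions, without sums of matrices.\<close>
  define mask where "mask S = mat d d (\<lambda>q. if q \<in> S then X $$ q else 0)" for S
  have E: "E p \<in> carrier_mat d d" and mask: "mask S \<in> carrier_mat d d" for p S
    by (auto simp: E_def mask_def)
  have "\<Phi> (mask S) $$ (i,j) = (\<Sum>p\<in>S. X $$ p * \<Phi> (E p) $$ (i,j))" if "finite S" for S
    using that
  proof (induction S rule: finite_induct)
    case empty
    have "mask {} = 0\<^sub>m d d" by (auto simp: mask_def)
    then show ?case using ij by (simp add: lin_map_zero_arg[OF \<Phi>])
  next
    case (insert p S)
    have "mask (insert p S) = X $$ p \<cdot>\<^sub>m E p + mask S"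
      using insert by (intro eq_matI) (auto simp: mask_def E_def)
    then have "\<Phi> (mask (insert p S)) = X $$ p \<cdot>\<^sub>m \<Phi> (E p) + \<Phi> (mask S)"
      by (simp add: lin_map_lin[OF \<Phi> E mask])
    then show ?case
      using insert ij carrier_matD[OF lin_map_carrier[OF \<Phi> E[of p]]]
        carrier_matD[OF lin_map_carrier[OF \<Phi> mask[of S]]] by simp
  qed
  from this[of "{..<d}\<times>{..<d}"] have
    "\<Phi> (mask ({..<d}\<times>{..<d})) $$ (i,j) = (\<Sum>p\<in>{..<d}\<times>{..<d}. X $$ p * \<Phi> (E p) $$ (i,j))" by simp
  moreover have "mask ({..<d}\<times>{..<d}) = X" using X by (intro eq_matI) (auto simp: mask_def)
  ultimately show "\<Phi> X $$ (i,j) = (\<Sum>p\<in>{..<d}\<times>{..<d}. X $$ p * \<Phi> (mat d d (\<lambda>q. if q = p then 1 else 0)) $$ (i,j))"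
    by (simp add: E_def)
qed

section \<open>Complete positivity through quadratic forms of block matrices\<close>

definition quad :: "nat \<Rightarrow> nat \<Rightarrow> (nat \<Rightarrow> nat \<Rightarrow> complex mat) \<Rightarrow> (nat \<Rightarrow> nat \<Rightarrow> complex) \<Rightarrow> complex" where
  "quad m d X v = (\<Sum>a<m. \<Sum>b<m. \<Sum>i<d. \<Sum>j<d. cnj (v a i) * X a b $$ (i,j) * v b j)"

text \<open>Test vectors are functions of a block index and an inner index, so no \<open>div\<close>
  and \<open>mod\<close> occur. Their values outside the index range do not enter
  \<open>quad\<close>, so quantifying over all functions is harmless.\<close>

definition pos_blocks :: "nat \<Rightarrow> nat \<Rightarrow> (nat \<Rightarrow> nat \<Rightarrow> complex mat) \<Rightarrow> bool" where
  "pos_blocks m d X \<longleftrightarrow> (\<forall>v. quad m d X v \<in> \<real>\<^sub>\<ge>\<^sub>0)"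

text \<open>Source and target dimensions may differ, unlike in
  \<open>completely_positive_on\<close>; this is what allows composing a generator on the large
  space with maps to and from the reduced one.\<close>

definition cp_map :: "nat \<Rightarrow> nat \<Rightarrow> (complex mat \<Rightarrow> complex mat) \<Rightarrow> bool" where
  "cp_map d d' \<Phi> \<longleftrightarrow> lin_map d d' \<Phi> \<and>
     (\<forall>m X. (\<forall>a<m. \<forall>b<m. X a b \<in> carrier_mat d d) \<longrightarrow> pos_blocks m d X \<longrightarrow>
        pos_blocks m d' (\<lambda>a b. \<Phi> (X a b)))"

lemma sum_lessThan_mult:
  fixes f :: "nat \<Rightarrow> 'a::comm_monoid_add"
  shows "(\<Sum>i<m * d. f i) = (\<Sum>a<m. \<Sum>i<d. f (a * d + i))"
proof -
  have "sum f {a * d..<a * d + d} = (\<Sum>i<d. f (a * d + i))" for a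
    using sum.shift_bounds_nat_ivl[of f 0 "a*d" d] by (simp add: lessThan_atLeast0 add.commute)
  then show ?thesis using sum.nat_group[of f d m] by simp
qed

lemma div_mod_offset: "i < (d::nat) \<Longrightarrow> (a * d + i) div d = a" "i < d \<Longrightarrow> (a * d + i) mod d = i"
  by auto

lemma offset_less: "a < m \<Longrightarrow> i < d \<Longrightarrow> a * d + i < m * (d::nat)"
proof -
  assume "a < m" "i < d"
  then have "a * d + i < Suc a * d" by simp
  also have "\<dots> \<le> m * d" using \<open>a < m\<close> by (intro mult_right_mono) auto
  finally show ?thesis .
qed

text \<open>Writing the flat index as \<open>a * d + i\<close> identifies vectors of length
  \<open>m * d\<close> with doubly indexed test vectors. Through this equivalence everything below
  is translated back to the official notion of positivity.\<close>

lemma psd_block_mat_iff: "psd (m * d) (block_mat m d X) \<longleftrightarrow> pos_blocks m d X"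
proof -
  have form: "(\<Sum>i<m*d. cnj (v $ i) * (block_mat m d X *\<^sub>v v) $ i) = quad m d X (\<lambda>a i. v $ (a * d + i))"
    if v: "v \<in> carrier_vec (m * d)" for v
  proof -
    have "(\<Sum>i<m*d. cnj (v $ i) * (block_mat m d X *\<^sub>v v) $ i)
      = (\<Sum>i<m*d. \<Sum>j<m*d. cnj (v $ i) * block_mat m d X $$ (i,j) * v $ j)"
      using v by (intro sum.cong refl)
        (auto simp: block_mat_def scalar_prod_def sum_distrib_left lessThan_atLeast0 mult.assoc intro!: sum.cong)
    also have "\<dots> = (\<Sum>a<m. \<Sum>i<d. \<Sum>b<m. \<Sum>j<d. cnj (v $ (a*d+i)) * X a b $$ (i,j) * v $ (b*d+j))"
      by (simp add: sum_lessThan_mult) (auto simp: block_mat_def offset_less div_mod_offset intro!: sum.cong)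
    also have "\<dots> = quad m d X (\<lambda>a i. v $ (a * d + i))"
      unfolding quad_def by (rule sum.cong[OF refl], rule sum.swap)
    finally show ?thesis .
  qed
  have nonneg: "(\<exists>r::real. r \<ge> 0 \<and> z = complex_of_real r) \<longleftrightarrow> z \<in> \<real>\<^sub>\<ge>\<^sub>0" for z
    by (auto elim: nonneg_Reals_cases)
  show ?thesis
  proof
    assume A: "psd (m * d) (block_mat m d X)"
    show "pos_blocks m d X" unfolding pos_blocks_def
    proof
      fix v :: "nat \<Rightarrow> nat \<Rightarrow> complex"
      define w where "w = vec (m*d) (\<lambda>i. v (i div d) (i mod d))"
      have "quad m d X v = quad m d X (\<lambda>a i. w $ (a * d + i))"
        unfolding quad_def w_def by (intro sum.cong refl) (simp add: offset_less div_mod_offset)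
      moreover have "\<dots> \<in> \<real>\<^sub>\<ge>\<^sub>0"
      proof -
        have w: "w \<in> carrier_vec (m * d)" by (simp add: w_def)
        then show ?thesis using A form[OF w] unfolding psd_def nonneg by metis
      qed
      ultimately show "quad m d X v \<in> \<real>\<^sub>\<ge>\<^sub>0" by simp
    qed
  next
    assume "pos_blocks m d X"
    then show "psd (m * d) (block_mat m d X)"
      unfolding psd_def nonneg by (simp add: form pos_blocks_def) (simp add: block_mat_def)
  qed
qed

text \<open>A Kraus representation moves each operator \<open>V r\<close> onto the test vector, so
  the form of the image is a sum of forms of the original block matrix. The operators are plain
  functions over an arbitrary index type, which lets later witnesses be written as index
  formulas.\<close>

lemma cp_mapI_kraus:
  fixes V :: "'r \<Rightarrow> nat \<Rightarrow> nat \<Rightarrow> complex"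
  assumes carr: "\<And>X. X \<in> carrier_mat d d \<Longrightarrow> \<Phi> X \<in> carrier_mat d' d'"
    and entry: "\<And>X i j. X \<in> carrier_mat d d \<Longrightarrow> i < d' \<Longrightarrow> j < d' \<Longrightarrow>
      \<Phi> X $$ (i,j) = (\<Sum>r\<in>F. \<Sum>k<d. \<Sum>l<d. V r i k * X $$ (k,l) * cnj (V r j l))"
  shows "cp_map d d' \<Phi>"
  unfolding cp_map_def
proof (intro conjI allI impI)
  show "lin_map d d' \<Phi>"
  proof (rule lin_mapI)
    fix X Y :: "complex mat" and c assume X: "X \<in> carrier_mat d d" and Y: "Y \<in> carrier_mat d d"
    note [simp] = carrier_matD[OF carr[OF X]] carrier_matD[OF carr[OF Y]] carrier_matD[OF X] carrier_matD[OF Y]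
    have Z: "c \<cdot>\<^sub>m X + Y \<in> carrier_mat d d" using X Y by simp
    show "\<Phi> (c \<cdot>\<^sub>m X + Y) = c \<cdot>\<^sub>m \<Phi> X + \<Phi> Y"
    proof (rule eq_matI)
      fix i j assume "i < dim_row (c \<cdot>\<^sub>m \<Phi> X + \<Phi> Y)" "j < dim_col (c \<cdot>\<^sub>m \<Phi> X + \<Phi> Y)"
      then have ij: "i < d'" "j < d'" by auto
      then show "\<Phi> (c \<cdot>\<^sub>m X + Y) $$ (i,j) = (c \<cdot>\<^sub>m \<Phi> X + \<Phi> Y) $$ (i,j)"
        by (simp add: entry[OF X ij] entry[OF Y ij] entry[OF Z ij] sum_distrib_left sum.distrib[symmetric])
          (intro sum.cong refl, simp add: algebra_simps)
    qed (use carr[OF Z] in auto)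
  qed (rule carr)
next
  fix m X assume X: "\<forall>a<m. \<forall>b<m. X a b \<in> carrier_mat d d" and pos: "pos_blocks m d X"
  show "pos_blocks m d' (\<lambda>a b. \<Phi> (X a b))" unfolding pos_blocks_def
  proof
    fix v :: "nat \<Rightarrow> nat \<Rightarrow> complex"
    \<comment> \<open>This is the adjoint of \<open>V r\<close> applied to the block
      \<open>v a\<close>. The chain of swaps that follows only brings \<open>r\<close>,
      \<open>k\<close>, \<open>l\<close> to the front so that these sums factor out.\<close>
    define u where "u r a k = (\<Sum>i<d'. cnj (V r i k) * v a i)" for r a k
    have block: "(\<Sum>i<d'. \<Sum>j<d'. cnj (v a i) * \<Phi> (X a b) $$ (i,j) * v b j)
        = (\<Sum>r\<in>F. \<Sum>k<d. \<Sum>l<d. cnj (u r a k) * X a b $$ (k,l) * u r b l)" if "a < m" "b < m" for a b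
    proof -
      have Xab: "X a b \<in> carrier_mat d d" using X that by simp
      have "(\<Sum>i<d'. \<Sum>j<d'. cnj (v a i) * \<Phi> (X a b) $$ (i,j) * v b j)
        = (\<Sum>i<d'. \<Sum>j<d'. \<Sum>r\<in>F. \<Sum>k<d. \<Sum>l<d.
             cnj (v a i) * (V r i k * X a b $$ (k,l) * cnj (V r j l)) * v b j)"
        by (intro sum.cong refl) (simp add: entry[OF Xab] sum_distrib_left sum_distrib_right)
      also have "\<dots> = (\<Sum>i<d'. \<Sum>r\<in>F. \<Sum>j<d'. \<Sum>k<d. \<Sum>l<d.
             cnj (v a i) * (V r i k * X a b $$ (k,l) * cnj (V r j l)) * v b j)"
        by (rule sum.cong[OF refl], rule sum.swap)
      also have "\<dots> = (\<Sum>r\<in>F. \<Sum>i<d'. \<Sum>j<d'. \<Sum>k<d. \<Sum>l<d.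
             cnj (v a i) * (V r i k * X a b $$ (k,l) * cnj (V r j l)) * v b j)"
        by (rule sum.swap)
      also have "\<dots> = (\<Sum>r\<in>F. \<Sum>i<d'. \<Sum>k<d. \<Sum>j<d'. \<Sum>l<d.
             cnj (v a i) * (V r i k * X a b $$ (k,l) * cnj (V r j l)) * v b j)"
        by (rule sum.cong[OF refl], rule sum.cong[OF refl], rule sum.swap)
      also have "\<dots> = (\<Sum>r\<in>F. \<Sum>k<d. \<Sum>i<d'. \<Sum>j<d'. \<Sum>l<d.
             cnj (v a i) * (V r i k * X a b $$ (k,l) * cnj (V r j l)) * v b j)"
        by (rule sum.cong[OF refl], rule sum.swap)
      also have "\<dots> = (\<Sum>r\<in>F. \<Sum>k<d. \<Sum>i<d'. \<Sum>l<d. \<Sum>j<d'.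
             cnj (v a i) * (V r i k * X a b $$ (k,l) * cnj (V r j l)) * v b j)"
        by (rule sum.cong[OF refl], rule sum.cong[OF refl], rule sum.cong[OF refl], rule sum.swap)
      also have "\<dots> = (\<Sum>r\<in>F. \<Sum>k<d. \<Sum>l<d. \<Sum>i<d'. \<Sum>j<d'.
             cnj (v a i) * (V r i k * X a b $$ (k,l) * cnj (V r j l)) * v b j)"
        by (rule sum.cong[OF refl], rule sum.cong[OF refl], rule sum.swap)
      also have "\<dots> = (\<Sum>r\<in>F. \<Sum>k<d. \<Sum>l<d. cnj (u r a k) * X a b $$ (k,l) * u r b l)"
        by (intro sum.cong refl) (simp add: u_def sum_distrib_left sum_distrib_right mult_ac)
      finally show ?thesis .
    qed
    have "quad m d' (\<lambda>a b. \<Phi> (X a b)) v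
      = (\<Sum>a<m. \<Sum>b<m. \<Sum>r\<in>F. \<Sum>k<d. \<Sum>l<d. cnj (u r a k) * X a b $$ (k,l) * u r b l)"
      unfolding quad_def by (intro sum.cong refl) (simp add: block)
    also have "\<dots> = (\<Sum>a<m. \<Sum>r\<in>F. \<Sum>b<m. \<Sum>k<d. \<Sum>l<d. cnj (u r a k) * X a b $$ (k,l) * u r b l)"
      by (rule sum.cong[OF refl], rule sum.swap)
    also have "\<dots> = (\<Sum>r\<in>F. quad m d X (u r))"
      unfolding quad_def by (rule sum.swap)
    \<comment> \<open>If \<open>F\<close> is infinite, the sum is 0 by convention and the claim
      still holds.\<close>
    also have "\<dots> \<in> \<real>\<^sub>\<ge>\<^sub>0"
      using pos by (induction F rule: infinite_finite_induct) (auto simp: pos_blocks_def)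
    finally show "quad m d' (\<lambda>a b. \<Phi> (X a b)) v \<in> \<real>\<^sub>\<ge>\<^sub>0" .
  qed
qed

lemma cp_map_lin: "cp_map d d' \<Phi> \<Longrightarrow> lin_map d d' \<Phi>"
  by (simp add: cp_map_def)

lemma cp_map_pos:
  "cp_map d d' \<Phi> \<Longrightarrow> (\<And>a b. a < m \<Longrightarrow> b < m \<Longrightarrow> X a b \<in> carrier_mat d d) \<Longrightarrow> pos_blocks m d X \<Longrightarrow>
     pos_blocks m d' (\<lambda>a b. \<Phi> (X a b))"
  by (simp add: cp_map_def)

lemma cp_map_comp:
  assumes "cp_map d d' \<Phi>" "cp_map d' d'' \<Psi>"
  shows "cp_map d d'' (\<lambda>X. \<Psi> (\<Phi> X))"
  unfolding cp_map_def
proof (intro conjI allI impI)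
  fix m X assume X: "\<forall>a<m. \<forall>b<m. X a b \<in> carrier_mat d d" "pos_blocks m d X"
  then have "pos_blocks m d' (\<lambda>a b. \<Phi> (X a b))" by (intro cp_map_pos[OF assms(1)]) auto
  then show "pos_blocks m d'' (\<lambda>a b. \<Psi> (\<Phi> (X a b)))"
    using X by (intro cp_map_pos[OF assms(2)]) (auto intro: lin_map_carrier[OF cp_map_lin[OF assms(1)]])
qed (use assms lin_map_comp cp_map_lin in blast)

lemma quad_lincomb:
  assumes "\<And>a b. a < m \<Longrightarrow> b < m \<Longrightarrow> X a b \<in> carrier_mat d d"
    and "\<And>a b. a < m \<Longrightarrow> b < m \<Longrightarrow> Y a b \<in> carrier_mat d d"
  shows "quad m d (\<lambda>a b. c \<cdot>\<^sub>m X a b + Y a b) v = c * quad m d X v + quad m d Y v"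
  unfolding quad_def sum_distrib_left sum.distrib[symmetric]
proof (intro sum.cong refl, goal_cases)
  case (1 a b i j)
  then have "X a b \<in> carrier_mat d d" "Y a b \<in> carrier_mat d d" using assms by auto
  then have [simp]: "(c \<cdot>\<^sub>m X a b + Y a b) $$ (i,j) = c * X a b $$ (i,j) + Y a b $$ (i,j)" using 1 by auto
  show ?case by (simp add: algebra_simps)
qed

lemma cp_map_lincomb:
  assumes \<Phi>: "cp_map d d' \<Phi>" and \<Psi>: "cp_map d d' \<Psi>" and c: "c \<in> \<real>\<^sub>\<ge>\<^sub>0"
  shows "cp_map d d' (\<lambda>X. c \<cdot>\<^sub>m \<Phi> X + \<Psi> X)"
  unfolding cp_map_def
proof (intro conjI allI impI)
  show "lin_map d d' (\<lambda>X. c \<cdot>\<^sub>m \<Phi> X + \<Psi> X)"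
    by (intro lin_map_add lin_map_smult cp_map_lin assms)
next
  fix m X assume X: "\<forall>a<m. \<forall>b<m. X a b \<in> carrier_mat d d" and pos: "pos_blocks m d X"
  have "quad m d' (\<lambda>a b. c \<cdot>\<^sub>m \<Phi> (X a b) + \<Psi> (X a b)) v =
      c * quad m d' (\<lambda>a b. \<Phi> (X a b)) v + quad m d' (\<lambda>a b. \<Psi> (X a b)) v" for v
    using X by (intro quad_lincomb) (auto intro: lin_map_carrier cp_map_lin \<Phi> \<Psi>)
  then show "pos_blocks m d' (\<lambda>a b. c \<cdot>\<^sub>m \<Phi> (X a b) + \<Psi> (X a b))"
    using cp_map_pos[OF \<Phi> _ pos] cp_map_pos[OF \<Psi> _ pos] X c by (simp add: pos_blocks_def)
qed

section \<open>Adjoints and conjugation by a matrix\<close>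

lemma adj_carrier [simp]: "A \<in> carrier_mat r c \<Longrightarrow> adj A \<in> carrier_mat c r"
  by (auto simp: adj_def)

lemma adj_dim [simp]: "dim_row (adj A) = dim_col A" "dim_col (adj A) = dim_row A"
  by (auto simp: adj_def)

lemma adj_index [simp]: "i < dim_col A \<Longrightarrow> j < dim_row A \<Longrightarrow> adj A $$ (i,j) = cnj (A $$ (j,i))"
  by (auto simp: adj_def)

lemma index_mult_mat_sum:
  "i < dim_row A \<Longrightarrow> j < dim_col B \<Longrightarrow> dim_row B = dim_col A \<Longrightarrow>
     (A * B) $$ (i,j) = (\<Sum>k<dim_col A. A $$ (i,k) * B $$ (k,j))"
  by (auto simp: scalar_prod_def lessThan_atLeast0 intro!: sum.cong)

lemma conj_index:
  assumes "V \<in> carrier_mat d' d" "X \<in> carrier_mat d d" "i < d'" "j < d'"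
  shows "(V * X * adj V) $$ (i,j) = (\<Sum>k<d. \<Sum>l<d. V $$ (i,k) * X $$ (k,l) * cnj (V $$ (j,l)))"
proof -
  have "(V * X * adj V) $$ (i,j) = (\<Sum>l<d. \<Sum>k<d. V $$ (i,k) * X $$ (k,l) * cnj (V $$ (j,l)))"
    using assms by (auto simp: index_mult_mat_sum sum_distrib_right simp del: index_mult_mat(1) intro!: sum.cong)
  also have "\<dots> = (\<Sum>k<d. \<Sum>l<d. V $$ (i,k) * X $$ (k,l) * cnj (V $$ (j,l)))"
    by (rule sum.swap)
  finally show ?thesis .
qed

lemma cp_map_conj:
  assumes "V \<in> carrier_mat d' d"
  shows "cp_map d d' (\<lambda>X. V * X * adj V)"
  by (rule cp_mapI_kraus[where F = "{()}" and V = "\<lambda>_ i k. V $$ (i,k)"])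
    (use assms in \<open>auto simp: conj_index simp del: index_mult_mat(1)\<close>)

section \<open>Exponentials of linear maps on matrices\<close>

text \<open>An operator bound with respect to the largest entry. Phrasing it for every entry bound
  \<open>B\<close> makes it iterate by substitution.\<close>

definition entry_bound :: "nat \<Rightarrow> real \<Rightarrow> (complex mat \<Rightarrow> complex mat) \<Rightarrow> bool" where
  "entry_bound d C \<Phi> \<longleftrightarrow> (\<forall>X\<in>carrier_mat d d. \<forall>B. (\<forall>i<d. \<forall>j<d. norm (X $$ (i,j)) \<le> B) \<longrightarrow>
     (\<forall>i<d. \<forall>j<d. norm (\<Phi> X $$ (i,j)) \<le> C * B))"

lemma lin_map_entry_bound:
  assumes "lin_map d d \<Phi>"
  obtains C where "entry_bound d C \<Phi>"
proof -
  obtain \<kappa> where \<kappa>: "\<forall>X i j. X \<in> carrier_mat d d \<longrightarrow> i < d \<longrightarrow> j < d \<longrightarrow>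
    \<Phi> X $$ (i,j) = (\<Sum>p\<in>{..<d}\<times>{..<d}. X $$ p * \<kappa> p i j)"
    using lin_map_entry[OF assms] by (elim exE)
  define C where "C = (\<Sum>i<d. \<Sum>j<d. \<Sum>p\<in>{..<d}\<times>{..<d}. norm (\<kappa> p i j))"
  have "entry_bound d C \<Phi>" unfolding entry_bound_def
  proof (intro ballI allI impI)
    fix X :: "complex mat" and B i j assume X: "X \<in> carrier_mat d d" and B: "\<forall>i<d. \<forall>j<d. norm (X $$ (i,j)) \<le> B"
      and ij: "i < d" "j < d"
    have B0: "0 \<le> B" using B ij norm_ge_zero order_trans by blast
    have "norm (\<Phi> X $$ (i,j)) \<le> (\<Sum>p\<in>{..<d}\<times>{..<d}. norm (X $$ p * \<kappa> p i j))"
      unfolding \<kappa>[rule_format, OF X ij] by (rule norm_sum)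
    also have "\<dots> \<le> (\<Sum>p\<in>{..<d}\<times>{..<d}. B * norm (\<kappa> p i j))"
      using B by (intro sum_mono) (auto simp: norm_mult intro!: mult_right_mono)
    also have "\<dots> = (\<Sum>p\<in>{..<d}\<times>{..<d}. norm (\<kappa> p i j)) * B"
      by (simp add: sum_distrib_left mult.commute)
    also have "\<dots> \<le> C * B"
    proof (rule mult_right_mono[OF _ B0])
      have "(\<Sum>p\<in>{..<d}\<times>{..<d}. norm (\<kappa> p i j)) \<le> (\<Sum>j<d. \<Sum>p\<in>{..<d}\<times>{..<d}. norm (\<kappa> p i j))"
        using ij by (intro member_le_sum) (auto intro: sum_nonneg)
      also have "\<dots> \<le> C" unfolding C_def
        using ij by (intro member_le_sum) (auto intro!: sum_nonneg)
      finally show "(\<Sum>p\<in>{..<d}\<times>{..<d}. norm (\<kappa> p i j)) \<le> C" .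
    qed
    finally show "norm (\<Phi> X $$ (i,j)) \<le> C * B" .
  qed
  then show ?thesis ..
qed

lemma entry_bound_funpow:
  assumes \<Phi>: "lin_map d d \<Phi>" and C: "entry_bound d C \<Phi>" and X: "X \<in> carrier_mat d d"
    and B: "\<And>i j. i < d \<Longrightarrow> j < d \<Longrightarrow> norm (X $$ (i,j)) \<le> B" and ij: "i < d" "j < d"
  shows "norm ((\<Phi> ^^ k) X $$ (i,j)) \<le> C ^ k * B"
  using ij
proof (induction k arbitrary: i j)
  case (Suc k)
  have "(\<Phi> ^^ k) X \<in> carrier_mat d d" by (rule lin_map_carrier[OF lin_map_funpow[OF \<Phi>] X])
  then have "norm (\<Phi> ((\<Phi> ^^ k) X) $$ (i,j)) \<le> C * (C ^ k * B)"
    using C Suc.IH Suc.prems unfolding entry_bound_def by simp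
  then show ?case by (simp add: mult.assoc)
qed (simp add: B)

lemma mat_entries_bounded:
  fixes X :: "complex mat"
  shows "\<exists>B. \<forall>i<d. \<forall>j<d. norm (X $$ (i,j)) \<le> B"
proof (intro exI allI impI)
  fix i j assume "i < d" "j < d"
  then have "norm (X $$ (i,j)) \<le> (\<Sum>j<d. norm (X $$ (i,j)))" by (intro member_le_sum) auto
  also have "\<dots> \<le> (\<Sum>i<d. \<Sum>j<d. norm (X $$ (i,j)))"
    using \<open>i < d\<close> by (intro member_le_sum) (auto intro: sum_nonneg)
  finally show "norm (X $$ (i,j)) \<le> (\<Sum>i<d. \<Sum>j<d. norm (X $$ (i,j)))" .
qed

text \<open>Geometric growth of the iterates is the source of convergence for every exponential
  series below.\<close>

lemma funpow_entry_growth: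
  assumes "lin_map d d \<Phi>" "X \<in> carrier_mat d d"
  shows "\<exists>C B. \<forall>k. \<forall>i<d. \<forall>j<d. norm ((\<Phi> ^^ k) X $$ (i,j)) \<le> C ^ k * B"
proof -
  obtain C where C: "entry_bound d C \<Phi>" using lin_map_entry_bound[OF assms(1)] .
  obtain B where "\<forall>i<d. \<forall>j<d. norm (X $$ (i,j)) \<le> B"
    using mat_entries_bounded[of d X] by (elim exE)
  then have "\<forall>k. \<forall>i<d. \<forall>j<d. norm ((\<Phi> ^^ k) X $$ (i,j)) \<le> C ^ k * B"
    by (simp add: entry_bound_funpow[OF assms(1) C assms(2)])
  then show ?thesis by blast
qed

lemma exp_series_abs_summable:
  fixes a :: "nat \<Rightarrow> complex"
  assumes "\<And>n. norm (a n) \<le> C ^ n * B"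
  shows "summable (\<lambda>n. norm (complex_of_real (t ^ n / fact n) * a n))"
proof (rule summable_comparison_test')
  show "summable (\<lambda>n. B * (inverse (fact n) * (\<bar>t\<bar> * C) ^ n))"
    by (intro summable_mult summable_exp)
  fix n :: nat
  have "norm (complex_of_real (t ^ n / fact n) * a n) \<le> \<bar>t\<bar> ^ n / fact n * (C ^ n * B)"
    unfolding norm_mult using assms[of n] by (intro mult_mono) (auto simp: norm_divide norm_power)
  then show "norm (norm (complex_of_real (t ^ n / fact n) * a n)) \<le> B * (inverse (fact n) * (\<bar>t\<bar> * C) ^ n)"
    by (simp add: power_mult_distrib field_simps)
qed

text \<open>This is the scalar core of the semigroup law: the binomial theorem summed along the
  antidiagonals \<open>n + m = N\<close>. Because \<open>a (n + m)\<close> does not split into a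
  factor in \<open>m\<close> and one in \<open>n\<close>, a Cauchy product does not apply; the
  double series is shown absolutely summable and summed in two orders.\<close>

lemma exp_series_add:
  fixes a :: "nat \<Rightarrow> complex"
  assumes a: "\<And>n. norm (a n) \<le> C ^ n * B"
  shows "(\<Sum>m. complex_of_real (s ^ m / fact m) * (\<Sum>n. complex_of_real (t ^ n / fact n) * a (n + m)))
    = (\<Sum>N. complex_of_real ((s + t) ^ N / fact N) * a N)"
proof -
  define f where "f = (\<lambda>(m,n). complex_of_real (s ^ m / fact m) * (complex_of_real (t ^ n / fact n) * a (n + m)))"
  \<comment> \<open>Unlike \<open>f\<close>, the majorant factors, since the bound on
    \<open>a (n + m)\<close> is a power with exponent \<open>n + m\<close>. Its iterated sum is a
    product of two exponentials.\<close>
  define g where "g = (\<lambda>(m,n). (B * (\<bar>s * C\<bar> ^ m / fact m)) * (\<bar>t * C\<bar> ^ n / fact n))"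
  have B: "0 \<le> B" using a[of 0] norm_ge_zero[of "a 0"] by (simp del: norm_ge_zero)
  have exp: "((\<lambda>n. x ^ n / fact n) has_sum exp x) UNIV" if "x \<ge> 0" for x :: real
    using exp_converges[of x] that
    by (intro sums_nonneg_imp_has_sum_strong) (auto simp: divide_inverse mult.commute)
  have "g summable_on UNIV \<times> UNIV"
  proof (rule summable_on_SigmaI)
    show "((\<lambda>n. g (m, n)) has_sum (B * (\<bar>s * C\<bar> ^ m / fact m) * exp \<bar>t * C\<bar>)) UNIV" for m
      unfolding g_def prod.case by (intro has_sum_cmult_right exp) auto
    show "(\<lambda>m. B * (\<bar>s * C\<bar> ^ m / fact m) * exp \<bar>t * C\<bar>) summable_on UNIV"
      by (intro summable_on_cmult_left summable_on_cmult_right has_sum_imp_summable[OF exp]) auto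
    show "0 \<le> g (m, n)" for m n using B by (simp add: g_def)
  qed
  then have "(\<lambda>x. norm (f x)) summable_on UNIV \<times> UNIV"
  proof (rule abs_summable_on_comparison_test')
    fix x :: "nat \<times> nat"
    obtain m n where [simp]: "x = (m,n)" by force
    have "norm (a (n + m)) \<le> \<bar>C\<bar> ^ (n + m) * B"
      using a[of "n+m"] mult_right_mono[OF abs_ge_self[of "C ^ (n+m)"] B] by (simp add: power_abs)
    then have "norm (f x) \<le> (\<bar>s\<bar> ^ m / fact m) * ((\<bar>t\<bar> ^ n / fact n) * (\<bar>C\<bar> ^ (n + m) * B))"
      unfolding f_def by (simp add: norm_mult norm_divide norm_power divide_right_mono mult_left_mono del: times_divide_eq_left)
    also have "\<dots> = g x" by (simp add: g_def abs_mult power_mult_distrib power_add)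
    finally show "norm (f x) \<le> g x" .
  qed
  then have f: "f summable_on UNIV \<times> UNIV" by (rule abs_summable_summable)
  have inner: "summable (\<lambda>n. norm (complex_of_real (t ^ n / fact n) * a (n + m)))" for m
    by (rule exp_series_abs_summable[where C = C and B = "C ^ m * B"])
      (use a[of "_ + m"] in \<open>simp add: power_add mult.assoc\<close>)
  have "((\<lambda>n. f (m, n)) has_sum (complex_of_real (s ^ m / fact m) *
      (\<Sum>n. complex_of_real (t ^ n / fact n) * a (n + m)))) UNIV" for m
    unfolding f_def prod.case
    by (intro has_sum_cmult_right norm_summable_imp_has_sum inner summable_sums summable_norm_cancel[OF inner])
  from has_sum_SigmaD[OF has_sum_infsum[OF f] this]
  have 1: "(\<lambda>m. complex_of_real (s ^ m / fact m) * (\<Sum>n. complex_of_real (t ^ n / fact n) * a (n + m)))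
      sums infsum f (UNIV \<times> UNIV)"
    by (rule has_sum_imp_sums)
  \<comment> \<open>Reindexing by \<open>N = m + n\<close> and \<open>k = m\<close>: every fibre
    over \<open>N\<close> is finite and carries the constant value \<open>a N\<close>.\<close>
  define h where "h = (\<lambda>(N,k). f (k, N - k))"
  have "(f has_sum infsum f (UNIV \<times> UNIV)) (UNIV \<times> UNIV) \<longleftrightarrow>
      (h has_sum infsum f (UNIV \<times> UNIV)) (SIGMA N:UNIV. {..N})"
    by (rule has_sum_reindex_bij_witness[where i = "\<lambda>(N,k). (k, N - k)" and j = "\<lambda>(m,n). (m + n, m)"])
      (auto simp: h_def)
  with has_sum_infsum[OF f] have h: "(h has_sum infsum f (UNIV \<times> UNIV)) (SIGMA N:UNIV. {..N})" by simp
  have fin: "((\<lambda>k. h (N, k)) has_sum (complex_of_real ((s + t) ^ N / fact N) * a N)) {..N}" for N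
  proof -
    have "(\<Sum>k\<le>N. h (N, k)) = (\<Sum>k\<le>N. complex_of_real (s ^ k / fact k * (t ^ (N - k) / fact (N - k))) * a N)"
      by (intro sum.cong) (auto simp: h_def f_def)
    also have "\<dots> = complex_of_real (\<Sum>k\<le>N. s ^ k / fact k * (t ^ (N - k) / fact (N - k))) * a N"
      by (simp add: sum_distrib_right)
    also have "(\<Sum>k\<le>N. s ^ k / fact k * (t ^ (N - k) / fact (N - k))) = (s + t) ^ N / fact N"
      unfolding binomial_ring sum_divide_distrib
      by (intro sum.cong) (auto simp: binomial_fact field_simps)
    finally have "(\<Sum>k\<le>N. h (N, k)) = complex_of_real ((s + t) ^ N / fact N) * a N" .
    then show ?thesis by (metis finite_atMost has_sum_finite)
  qed
  have "(\<lambda>N. complex_of_real ((s + t) ^ N / fact N) * a N) sums infsum f (UNIV \<times> UNIV)"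
    by (rule has_sum_imp_sums[OF has_sum_SigmaD[OF h fin]])
  with 1 show ?thesis by (simp add: sums_iff)
qed

section \<open>The exponential of a linear map\<close>

lemma map_exp_carrier [simp]: "map_exp d \<Phi> t X \<in> carrier_mat d d"
  by (simp add: map_exp_def)

lemma map_exp_dim [simp]: "dim_row (map_exp d \<Phi> t X) = d" "dim_col (map_exp d \<Phi> t X) = d"
  by (simp_all add: map_exp_def)

text \<open>\<open>map_exp\<close> is defined by \<open>suminf\<close>, which is informative only
  for summable series; this is the form in which the exponential is used.\<close>

lemma map_exp_sums:
  assumes "lin_map d d \<Phi>" "X \<in> carrier_mat d d" "i < d" "j < d"
  shows "(\<lambda>n. complex_of_real (t ^ n / fact n) * ((\<Phi> ^^ n) X) $$ (i,j)) sums (map_exp d \<Phi> t X $$ (i,j))"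
proof -
  obtain C B where CB: "\<forall>k. \<forall>i<d. \<forall>j<d. norm ((\<Phi> ^^ k) X $$ (i,j)) \<le> C ^ k * B"
    using funpow_entry_growth[OF assms(1,2)] by (elim exE)
  from summable_norm_cancel[OF exp_series_abs_summable[OF CB[rule_format, OF assms(3,4)]]] show ?thesis
    using assms by (simp add: map_exp_def summable_sums)
qed

text \<open>Each entry of \<open>\<Psi>\<close> is a fixed finite combination of entries, so
  \<open>\<Psi>\<close> may be applied term by term. This serves the semigroup law, with an iterate
  for \<open>\<Psi>\<close>, and the invariance of the algebra, with its projection.\<close>

lemma lin_map_map_exp_sums:
  assumes \<Phi>: "lin_map d d \<Phi>" and X: "X \<in> carrier_mat d d" and \<Psi>: "lin_map d d' \<Psi>" and ij: "i < d'" "j < d'"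
  shows "(\<lambda>n. complex_of_real (t ^ n / fact n) * \<Psi> ((\<Phi> ^^ n) X) $$ (i,j)) sums (\<Psi> (map_exp d \<Phi> t X) $$ (i,j))"
proof -
  obtain \<kappa> where \<kappa>: "\<forall>X i j. X \<in> carrier_mat d d \<longrightarrow> i < d' \<longrightarrow> j < d' \<longrightarrow>
    \<Psi> X $$ (i,j) = (\<Sum>p\<in>{..<d}\<times>{..<d}. X $$ p * \<kappa> p i j)"
    using lin_map_entry[OF \<Psi>] by (elim exE)
  have "(\<lambda>n. \<Sum>p\<in>{..<d}\<times>{..<d}. complex_of_real (t ^ n / fact n) * ((\<Phi> ^^ n) X) $$ p * \<kappa> p i j)
      sums (\<Sum>p\<in>{..<d}\<times>{..<d}. map_exp d \<Phi> t X $$ p * \<kappa> p i j)"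
    by (intro sums_sum sums_mult2) (auto simp del: of_real_divide of_real_power intro!: map_exp_sums[OF \<Phi> X])
  then show ?thesis
    by (simp add: \<kappa>[rule_format, OF lin_map_carrier[OF lin_map_funpow[OF \<Phi>] X] ij] \<kappa>[rule_format, OF map_exp_carrier ij]
        sum_distrib_left mult.assoc)
qed

lemma lin_map_map_exp:
  assumes \<Phi>: "lin_map d d \<Phi>"
  shows "lin_map d d (map_exp d \<Phi> t)"
proof (rule lin_mapI)
  fix X Y :: "complex mat" and c assume X: "X \<in> carrier_mat d d" and Y: "Y \<in> carrier_mat d d"
  have Z: "c \<cdot>\<^sub>m X + Y \<in> carrier_mat d d" using X Y by simp
  show "map_exp d \<Phi> t (c \<cdot>\<^sub>m X + Y) = c \<cdot>\<^sub>m map_exp d \<Phi> t X + map_exp d \<Phi> t Y"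
  proof (rule eq_matI)
    fix i j assume "i < dim_row (c \<cdot>\<^sub>m map_exp d \<Phi> t X + map_exp d \<Phi> t Y)"
      "j < dim_col (c \<cdot>\<^sub>m map_exp d \<Phi> t X + map_exp d \<Phi> t Y)"
    then have ij: "i < d" "j < d" by auto
    have "((\<Phi> ^^ n) (c \<cdot>\<^sub>m X + Y)) $$ (i,j) = c * (\<Phi> ^^ n) X $$ (i,j) + (\<Phi> ^^ n) Y $$ (i,j)" for n
      using ij carrier_matD[OF lin_map_carrier[OF lin_map_funpow[OF \<Phi>] X], of n]
        carrier_matD[OF lin_map_carrier[OF lin_map_funpow[OF \<Phi>] Y], of n]
      by (simp add: lin_map_lin[OF lin_map_funpow[OF \<Phi>] X Y])
    then have "(\<lambda>n. c * (complex_of_real (t ^ n / fact n) * (\<Phi> ^^ n) X $$ (i,j)) +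
        complex_of_real (t ^ n / fact n) * (\<Phi> ^^ n) Y $$ (i,j)) sums (map_exp d \<Phi> t (c \<cdot>\<^sub>m X + Y) $$ (i,j))"
      using map_exp_sums[OF \<Phi> Z ij, of t] by (simp add: algebra_simps)
    moreover have "(\<lambda>n. c * (complex_of_real (t ^ n / fact n) * (\<Phi> ^^ n) X $$ (i,j)) +
        complex_of_real (t ^ n / fact n) * (\<Phi> ^^ n) Y $$ (i,j)) sums
        (c * map_exp d \<Phi> t X $$ (i,j) + map_exp d \<Phi> t Y $$ (i,j))"
      by (intro sums_add sums_mult map_exp_sums \<Phi> X Y ij)
    ultimately show "map_exp d \<Phi> t (c \<cdot>\<^sub>m X + Y) $$ (i,j) = (c \<cdot>\<^sub>m map_exp d \<Phi> t X + map_exp d \<Phi> t Y) $$ (i,j)"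
      using ij by (simp add: sums_unique2)
  qed auto
qed simp

lemma map_exp_0:
  assumes "X \<in> carrier_mat d d"
  shows "map_exp d \<Phi> 0 X = X"
proof (rule eq_matI)
  fix i j assume "i < dim_row X" "j < dim_col X"
  then have ij: "i < d" "j < d" using assms by auto
  \<comment> \<open>Only the term \<open>n = 0\<close> survives, by the convention
    \<open>0 ^ 0 = 1\<close>.\<close>
  have "(\<lambda>n. complex_of_real (0 ^ n / fact n) * ((\<Phi> ^^ n) X) $$ (i,j)) sums
      (complex_of_real (0 ^ 0 / fact 0) * ((\<Phi> ^^ 0) X) $$ (i,j))"
    by (intro sums_finite[of "{0}", simplified]) auto
  then show "map_exp d \<Phi> 0 X $$ (i,j) = X $$ (i,j)"
    using ij by (simp add: map_exp_def sums_iff)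
qed (use assms in auto)

lemma map_exp_add:
  assumes \<Phi>: "lin_map d d \<Phi>" and X: "X \<in> carrier_mat d d"
  shows "map_exp d \<Phi> (s + t) X = map_exp d \<Phi> s (map_exp d \<Phi> t X)"
proof (rule eq_matI)
  fix i j assume "i < dim_row (map_exp d \<Phi> s (map_exp d \<Phi> t X))" "j < dim_col (map_exp d \<Phi> s (map_exp d \<Phi> t X))"
  then have ij: "i < d" "j < d" by auto
  obtain C B where CB: "\<forall>k. \<forall>i<d. \<forall>j<d. norm ((\<Phi> ^^ k) X $$ (i,j)) \<le> C ^ k * B"
    using funpow_entry_growth[OF \<Phi> X] by (elim exE)
  have iter: "(\<Phi> ^^ (n + m)) X = (\<Phi> ^^ m) ((\<Phi> ^^ n) X)" for n m
    by (metis add.commute comp_apply funpow_add)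
  have "(\<Sum>n. complex_of_real (t ^ n / fact n) * (\<Phi> ^^ (n + m)) X $$ (i,j)) = (\<Phi> ^^ m) (map_exp d \<Phi> t X) $$ (i,j)" for m
    using lin_map_map_exp_sums[OF \<Phi> X lin_map_funpow[OF \<Phi>, of m] ij, of t]
    by (simp only: sums_iff iter)
  then show "map_exp d \<Phi> (s + t) X $$ (i,j) = map_exp d \<Phi> s (map_exp d \<Phi> t X) $$ (i,j)"
    using exp_series_add[OF CB[rule_format, OF ij], of s t] ij by (simp add: map_exp_def)
qed auto

text \<open>Each entry is a power series in a complex variable converging everywhere, hence
  continuous; the real time is then embedded into the complex plane.\<close>

lemma continuous_on_map_exp:
  assumes \<Phi>: "lin_map d d \<Phi>" and X: "X \<in> carrier_mat d d" and ij: "i < d" "j < d"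
  shows "continuous_on S (\<lambda>t. map_exp d \<Phi> t X $$ (i,j))"
proof -
  obtain C B where CB: "\<forall>k. \<forall>i<d. \<forall>j<d. norm ((\<Phi> ^^ k) X $$ (i,j)) \<le> C ^ k * B"
    using funpow_entry_growth[OF \<Phi> X] by (elim exE)
  define c where "c n = (\<Phi> ^^ n) X $$ (i,j) / fact n" for n
  have "summable (\<lambda>n. norm (c n * z ^ n))" for z
    using exp_series_abs_summable[OF CB[rule_format, OF ij], of "norm z"]
    by (simp add: c_def norm_mult norm_divide norm_power mult.commute[of "norm z ^ _"])
  then have "isCont (\<lambda>z. \<Sum>n. c n * z ^ n) z" for z
    by (intro isCont_powser_converges_everywhere) (rule summable_norm_cancel)
  then have "continuous_on UNIV (\<lambda>z. \<Sum>n. c n * z ^ n)"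
    by (intro continuous_at_imp_continuous_on ballI)
  then have "continuous_on S (\<lambda>t. \<Sum>n. c n * complex_of_real t ^ n)"
    by (rule continuous_on_compose2) (auto intro: continuous_on_of_real continuous_on_id)
  moreover have "c n * complex_of_real t ^ n = complex_of_real (t ^ n / fact n) * (\<Phi> ^^ n) X $$ (i,j)" for n t
    by (simp add: c_def)
  ultimately show ?thesis using ij by (simp add: map_exp_def)
qed

text \<open>The trace passes through the series, where only the zeroth term contributes. The
  hypothesis concerns the iterates at a single \<open>X\<close>, so vanishing traces on an invariant
  subset suffice.\<close>

lemma mtrace_map_exp:
  assumes \<Phi>: "lin_map d d \<Phi>" and X: "X \<in> carrier_mat d d"
    and tr: "\<And>k. mtrace ((\<Phi> ^^ Suc k) X) = 0"
  shows "mtrace (map_exp d \<Phi> t X) = mtrace X"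
proof -
  have c: "(\<Phi> ^^ n) X \<in> carrier_mat d d" for n by (rule lin_map_carrier[OF lin_map_funpow[OF \<Phi>] X])
  have "(\<lambda>n. \<Sum>i<d. complex_of_real (t ^ n / fact n) * ((\<Phi> ^^ n) X) $$ (i,i)) sums (\<Sum>i<d. map_exp d \<Phi> t X $$ (i,i))"
    by (intro sums_sum map_exp_sums[OF \<Phi> X]) auto
  then have 1: "(\<lambda>n. complex_of_real (t ^ n / fact n) * mtrace ((\<Phi> ^^ n) X)) sums mtrace (map_exp d \<Phi> t X)"
    by (simp add: mtrace_def sum_distrib_left carrier_matD[OF c])
  have "complex_of_real (t ^ n / fact n) * mtrace ((\<Phi> ^^ n) X) = 0" if "n \<notin> {0}" for n
    using that tr[of "n - 1"] by (cases n) auto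
  then have "(\<lambda>n. complex_of_real (t ^ n / fact n) * mtrace ((\<Phi> ^^ n) X)) sums mtrace X"
    using sums_finite[of "{0}" "\<lambda>n. complex_of_real (t ^ n / fact n) * mtrace ((\<Phi> ^^ n) X)"] by simp
  with 1 show ?thesis by (rule sums_unique2)
qed

section \<open>Semigroups from completely positive approximants\<close>

lemma nonneg_Reals_tendsto:
  fixes f :: "nat \<Rightarrow> complex"
  assumes "f \<longlonglongrightarrow> l" "\<And>n. f n \<in> \<real>\<^sub>\<ge>\<^sub>0"
  shows "l \<in> \<real>\<^sub>\<ge>\<^sub>0"
proof -
  have "(\<lambda>n. Re (f n)) \<longlonglongrightarrow> Re l" "(\<lambda>n. Im (f n)) \<longlonglongrightarrow> Im l"
    using assms(1) by (auto intro: tendsto_intros)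
  moreover have "Re (f n) \<ge> 0" "Im (f n) = 0" for n
    using assms(2)[of n] by (auto simp: complex_nonneg_Reals_iff)
  ultimately have "Re l \<ge> 0" "Im l = 0"
    by (auto intro: LIMSEQ_le_const simp: LIMSEQ_const_iff)
  then show ?thesis by (simp add: complex_nonneg_Reals_iff)
qed

lemma quad_tendsto:
  assumes "\<And>a b i j. a < m \<Longrightarrow> b < m \<Longrightarrow> i < d \<Longrightarrow> j < d \<Longrightarrow>
    (\<lambda>n. X n a b $$ (i,j)) \<longlonglongrightarrow> Y a b $$ (i,j)"
  shows "(\<lambda>n. quad m d (X n) v) \<longlonglongrightarrow> quad m d Y v"
  unfolding quad_def by (intro tendsto_sum tendsto_mult tendsto_const) (auto intro: assms)

lemma quad_sums:
  assumes "\<And>a b i j. a < m \<Longrightarrow> b < m \<Longrightarrow> i < d \<Longrightarrow> j < d \<Longrightarrow>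
    (\<lambda>n. c n * X n a b $$ (i,j)) sums (Y a b $$ (i,j))"
  shows "(\<lambda>n. c n * quad m d (X n) v) sums quad m d Y v"
proof -
  have "(\<lambda>n. \<Sum>a<m. \<Sum>b<m. \<Sum>i<d. \<Sum>j<d. cnj (v a i) * (c n * X n a b $$ (i,j)) * v b j) sums quad m d Y v"
    unfolding quad_def by (intro sums_sum sums_mult2 sums_mult) (auto intro: assms)
  then show ?thesis by (simp add: quad_def sum_distrib_left mult_ac)
qed

lemma cp_map_funpow_pos:
  assumes "cp_map d d \<Phi>" "\<And>a b. a < m \<Longrightarrow> b < m \<Longrightarrow> X a b \<in> carrier_mat d d" "pos_blocks m d X"
  shows "pos_blocks m d (\<lambda>a b. (\<Phi> ^^ k) (X a b))"
proof (induction k)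
  case (Suc k)
  from cp_map_pos[OF assms(1) _ this] show ?case
    using lin_map_carrier[OF lin_map_funpow[OF cp_map_lin[OF assms(1)]]] assms(2) by simp
qed (simp add: assms)

text \<open>For nonnegative \<open>t\<close> the partial sums are combinations of positive iterates
  with nonnegative coefficients, and the nonnegative reals are closed under limits.\<close>

lemma pos_blocks_map_exp:
  assumes \<Phi>: "cp_map d d \<Phi>" and X: "\<And>a b. a < m \<Longrightarrow> b < m \<Longrightarrow> X a b \<in> carrier_mat d d"
    and pos: "pos_blocks m d X" and t: "t \<ge> 0"
  shows "pos_blocks m d (\<lambda>a b. map_exp d \<Phi> t (X a b))"
  unfolding pos_blocks_def
proof
  fix v
  have "(\<lambda>n. complex_of_real (t ^ n / fact n) * quad m d (\<lambda>a b. (\<Phi> ^^ n) (X a b)) v) sums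
      quad m d (\<lambda>a b. map_exp d \<Phi> t (X a b)) v"
    by (intro quad_sums map_exp_sums cp_map_lin[OF \<Phi>] X)
  then have "(\<lambda>N. \<Sum>n<N. complex_of_real (t ^ n / fact n) * quad m d (\<lambda>a b. (\<Phi> ^^ n) (X a b)) v)
      \<longlonglongrightarrow> quad m d (\<lambda>a b. map_exp d \<Phi> t (X a b)) v"
    by (simp add: sums_def)
  then show "quad m d (\<lambda>a b. map_exp d \<Phi> t (X a b)) v \<in> \<real>\<^sub>\<ge>\<^sub>0"
  proof (rule nonneg_Reals_tendsto)
    fix N :: nat
    have "complex_of_real (t ^ n / fact n) * quad m d (\<lambda>a b. (\<Phi> ^^ n) (X a b)) v \<in> \<real>\<^sub>\<ge>\<^sub>0" for n
      using cp_map_funpow_pos[OF \<Phi> X pos, of n] t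
      by (intro nonneg_Reals_mult_I) (simp_all only: pos_blocks_def nonneg_Reals_of_real_iff, simp)
    then show "(\<Sum>n<N. complex_of_real (t ^ n / fact n) * quad m d (\<lambda>a b. (\<Phi> ^^ n) (X a b)) v) \<in> \<real>\<^sub>\<ge>\<^sub>0"
      by (induction N) (simp_all del: of_real_divide of_real_power)
  qed
qed

lemma funpow_invariant: "(\<And>X. X \<in> A \<Longrightarrow> \<Phi> X \<in> A) \<Longrightarrow> X \<in> A \<Longrightarrow> (\<Phi> ^^ k) X \<in> A"
  by (induction k) auto

text \<open>The binomial theorem for \<open>id\<close> plus a multiple of \<open>\<Lambda>\<close>.
  As \<open>M\<close> has this form on \<open>A\<close> only, the induction peels off the innermost
  application, replaces \<open>X\<close> by \<open>M X\<close>, and needs that point to remain in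
  \<open>A\<close>.\<close>

lemma funpow_id_plus:
  assumes \<Lambda>: "lin_map d d \<Lambda>" and A: "A \<subseteq> carrier_mat d d"
    and inv: "\<And>X. X \<in> A \<Longrightarrow> \<Lambda> X \<in> A" "\<And>X. X \<in> A \<Longrightarrow> M X \<in> A"
    and M: "\<And>X. X \<in> A \<Longrightarrow> M X = c \<cdot>\<^sub>m \<Lambda> X + X"
    and X: "X \<in> A" and ij: "i < d" "j < d"
  shows "(M ^^ n) X $$ (i,j) = (\<Sum>k\<le>n. of_nat (n choose k) * c ^ k * (\<Lambda> ^^ k) X $$ (i,j))"
  using X
proof (induction n arbitrary: X)
  case (Suc n)
  have cX: "X \<in> carrier_mat d d" and c\<Lambda>: "\<Lambda> X \<in> carrier_mat d d" using Suc.prems A inv by auto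
  define f where "f k = (\<Lambda> ^^ k) X $$ (i,j)" for k
  have f: "(\<Lambda> ^^ k) (M X) $$ (i,j) = c * f (Suc k) + f k" for k
    using ij carrier_matD[OF lin_map_carrier[OF lin_map_funpow[OF \<Lambda>] c\<Lambda>], of k]
      carrier_matD[OF lin_map_carrier[OF lin_map_funpow[OF \<Lambda>] cX], of k]
    by (simp add: M[OF Suc.prems] lin_map_lin[OF lin_map_funpow[OF \<Lambda>] c\<Lambda> cX] f_def funpow_swap1)
  have "(M ^^ Suc n) X $$ (i,j) = (M ^^ n) (M X) $$ (i,j)" by (simp add: funpow_swap1)
  also have "\<dots> = (\<Sum>k\<le>n. of_nat (n choose k) * c ^ k * (c * f (Suc k) + f k))"
    using Suc.IH[OF inv(2)[OF Suc.prems]] by (simp add: f)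
  also have "\<dots> = (\<Sum>k\<le>n. of_nat (n choose k) * c ^ Suc k * f (Suc k)) + (\<Sum>k\<le>n. of_nat (n choose k) * c ^ k * f k)"
    by (simp add: sum.distrib[symmetric] algebra_simps)
  \<comment> \<open>The added term vanishes since \<open>n choose Suc n = 0\<close>. With it the
    range can be shifted, and Pascal's rule applies term by term.\<close>
  also have "(\<Sum>k\<le>n. of_nat (n choose k) * c ^ k * f k) = (\<Sum>k\<le>Suc n. of_nat (n choose k) * c ^ k * f k)"
    by simp
  also have "\<dots> = f 0 + (\<Sum>k\<le>n. of_nat (n choose Suc k) * c ^ Suc k * f (Suc k))"
    by (subst sum.atMost_Suc_shift) simp
  also have "(\<Sum>k\<le>n. of_nat (n choose k) * c ^ Suc k * f (Suc k)) +
      (f 0 + (\<Sum>k\<le>n. of_nat (n choose Suc k) * c ^ Suc k * f (Suc k))) =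
      f 0 + (\<Sum>k\<le>n. of_nat (Suc n choose Suc k) * c ^ Suc k * f (Suc k))"
    by (simp add: sum.distrib[symmetric] algebra_simps)
  also have "\<dots> = (\<Sum>k\<le>Suc n. of_nat (Suc n choose k) * c ^ k * f k)"
    by (subst sum.atMost_Suc_shift) (simp del: binomial_Suc_Suc power_Suc)
  finally show ?case by (simp only: f_def)
qed simp

text \<open>The identity commutes with everything, so its exponential splits off as the scalar
  \<open>exp (t / \<epsilon>)\<close>. At the level of series this is a Cauchy product. The factor
  is positive, so positivity carries over from the exponential of \<open>M\<close> to that of
  \<open>\<Lambda>\<close>.\<close>

lemma map_exp_id_plus:
  assumes \<Lambda>: "lin_map d d \<Lambda>" and M': "lin_map d d M" and A: "A \<subseteq> carrier_mat d d"
    and inv: "\<And>X. X \<in> A \<Longrightarrow> \<Lambda> X \<in> A" "\<And>X. X \<in> A \<Longrightarrow> M X \<in> A"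
    and M: "\<And>X. X \<in> A \<Longrightarrow> M X = complex_of_real \<epsilon> \<cdot>\<^sub>m \<Lambda> X + X" and \<epsilon>: "\<epsilon> > 0"
    and X: "X \<in> A" and ij: "i < d" "j < d"
  shows "map_exp d M (t / \<epsilon>) X $$ (i,j) = complex_of_real (exp (t / \<epsilon>)) * map_exp d \<Lambda> t X $$ (i,j)"
proof -
  have cX: "X \<in> carrier_mat d d" using X A by auto
  define a where "a k = complex_of_real (t ^ k / fact k) * (\<Lambda> ^^ k) X $$ (i,j)" for k
  define b where "b k = complex_of_real ((t / \<epsilon>) ^ k / fact k)" for k
  obtain C B where CB: "\<forall>k. \<forall>i<d. \<forall>j<d. norm ((\<Lambda> ^^ k) X $$ (i,j)) \<le> C ^ k * B"
    using funpow_entry_growth[OF \<Lambda> cX] by (elim exE)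
  have a: "summable (\<lambda>k. norm (a k))" unfolding a_def
    by (rule exp_series_abs_summable[OF CB[rule_format, OF ij]])
  have b: "summable (\<lambda>k. norm (b k))"
    using exp_series_abs_summable[of "\<lambda>_. 1" 1 1 "t / \<epsilon>"] by (simp add: b_def)
  have "(\<lambda>n. (t / \<epsilon>) ^ n / fact n) sums exp (t / \<epsilon>)"
    using exp_converges[of "t / \<epsilon>"] by (simp add: divide_inverse mult.commute)
  then have sum_b: "suminf b = complex_of_real (exp (t / \<epsilon>))"
    unfolding b_def by (intro sums_unique[symmetric] sums_of_real)
  have sum_a: "suminf a = map_exp d \<Lambda> t X $$ (i,j)"
    using ij by (simp add: map_exp_def a_def[abs_def])
  \<comment> \<open>In the product of coefficients the powers of \<open>t / \<epsilon>\<close>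
    combine to exponent \<open>n\<close>, leaving \<open>n choose k\<close> and
    \<open>\<epsilon> ^ k\<close>: exactly the terms of the binomial expansion of the
    \<open>n\<close>-th iterate of \<open>M\<close>.\<close>
  have "(\<Sum>k\<le>n. a k * b (n - k)) = complex_of_real ((t / \<epsilon>) ^ n / fact n) * (M ^^ n) X $$ (i,j)" for n
  proof -
    have "a k * b (n - k) = complex_of_real ((t / \<epsilon>) ^ n / fact n) *
        (of_nat (n choose k) * complex_of_real \<epsilon> ^ k * (\<Lambda> ^^ k) X $$ (i,j))" if "k \<le> n" for k
    proof -
      have p: "(t / \<epsilon>) ^ n = (t / \<epsilon>) ^ k * (t / \<epsilon>) ^ (n - k)" using that by (simp add: power_add[symmetric])
      have "t ^ k / fact k * ((t / \<epsilon>) ^ (n - k) / fact (n - k)) =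
          (t / \<epsilon>) ^ n / fact n * (real (n choose k) * \<epsilon> ^ k)"
        using \<epsilon> that unfolding p by (simp add: binomial_fact power_divide field_simps)
      from arg_cong[OF this, of complex_of_real] have "complex_of_real (t ^ k / fact k) * b (n - k) =
          complex_of_real ((t / \<epsilon>) ^ n / fact n) * (of_nat (n choose k) * complex_of_real \<epsilon> ^ k)"
        by (simp only: b_def of_real_mult of_real_of_nat_eq of_real_power)
      moreover have "a k * b (n - k) = (complex_of_real (t ^ k / fact k) * b (n - k)) * (\<Lambda> ^^ k) X $$ (i,j)"
        unfolding a_def by (simp only: mult_ac)
      ultimately show ?thesis by (simp only: mult.assoc)
    qed
    then show ?thesis
      by (simp add: funpow_id_plus[OF \<Lambda> A inv M X ij] sum_distrib_left del: of_real_divide of_real_power)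
  qed
  with Cauchy_product_sums[OF a b] have
    "(\<lambda>n. complex_of_real ((t / \<epsilon>) ^ n / fact n) * (M ^^ n) X $$ (i,j)) sums
       (map_exp d \<Lambda> t X $$ (i,j) * complex_of_real (exp (t / \<epsilon>)))"
    by (simp only: sum_a sum_b)
  from sums_unique2[OF map_exp_sums[OF M' cX ij, of "t / \<epsilon>"] this] show ?thesis
    by (simp only: mult.commute)
qed

text \<open>The point is that \<open>C + C'\<close> is independent of \<epsilon>: restricting to
  \<epsilon> at most 1 gives one growth constant for all perturbed generators.\<close>

lemma entry_bound_perturb:
  assumes L: "lin_map d d L" "entry_bound d C L" and Q: "lin_map d d Q" "entry_bound d C' Q"
    and \<epsilon>: "0 \<le> \<epsilon>" "\<epsilon> \<le> 1"
  shows "entry_bound d (C + C') (\<lambda>X. L X + complex_of_real \<epsilon> \<cdot>\<^sub>m Q X)"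
  unfolding entry_bound_def
proof (intro ballI allI impI)
  fix X :: "complex mat" and B i j
  assume X: "X \<in> carrier_mat d d" and B: "\<forall>i<d. \<forall>j<d. norm (X $$ (i,j)) \<le> B" and ij: "i < d" "j < d"
  have l: "norm (L X $$ (i,j)) \<le> C * B" using L(2) X B ij by (auto simp: entry_bound_def)
  have q: "norm (Q X $$ (i,j)) \<le> C' * B" using Q(2) X B ij by (auto simp: entry_bound_def)
  have "norm (complex_of_real \<epsilon> * Q X $$ (i,j)) \<le> 1 * norm (Q X $$ (i,j))"
    unfolding norm_mult using \<epsilon> by (intro mult_right_mono) auto
  then have "norm (L X $$ (i,j) + complex_of_real \<epsilon> * Q X $$ (i,j)) \<le> C * B + C' * B"
    using norm_triangle_ineq[of "L X $$ (i,j)" "complex_of_real \<epsilon> * Q X $$ (i,j)"] l q by linarith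
  then show "norm ((L X + complex_of_real \<epsilon> \<cdot>\<^sub>m Q X) $$ (i,j)) \<le> (C + C') * B"
    using ij carrier_matD[OF lin_map_carrier[OF L(1) X]] carrier_matD[OF lin_map_carrier[OF Q(1) X]]
    by (simp add: algebra_simps)
qed

lemma lin_map_tendsto:
  assumes \<Phi>: "lin_map d d \<Phi>" and X: "\<And>n. X n \<in> carrier_mat d d" "Y \<in> carrier_mat d d"
    and lim: "\<And>i j. i < d \<Longrightarrow> j < d \<Longrightarrow> (\<lambda>n. X n $$ (i,j)) \<longlonglongrightarrow> Y $$ (i,j)" and ij: "i < d" "j < d"
  shows "(\<lambda>n. \<Phi> (X n) $$ (i,j)) \<longlonglongrightarrow> \<Phi> Y $$ (i,j)"
proof -
  obtain \<kappa> where \<kappa>: "\<forall>X i j. X \<in> carrier_mat d d \<longrightarrow> i < d \<longrightarrow> j < d \<longrightarrow>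
    \<Phi> X $$ (i,j) = (\<Sum>p\<in>{..<d}\<times>{..<d}. X $$ p * \<kappa> p i j)"
    using lin_map_entry[OF \<Phi>] by (elim exE)
  show ?thesis
    unfolding \<kappa>[rule_format, OF X(1) ij] \<kappa>[rule_format, OF X(2) ij]
    by (intro tendsto_sum tendsto_mult tendsto_const) (auto intro: lim)
qed

text \<open>Dominated convergence for series (Tannery): every iterate converges, by induction on the
  exponent, and the uniform growth constant provides a summable majorant.\<close>

lemma map_exp_perturb_tendsto:
  assumes L: "lin_map d d L" and Q: "lin_map d d Q" and X: "X \<in> carrier_mat d d" and ij: "i < d" "j < d"
    and \<epsilon>: "\<And>n. 0 \<le> \<epsilon> n" "\<And>n. \<epsilon> n \<le> 1" "\<epsilon> \<longlonglongrightarrow> 0"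
  shows "(\<lambda>n. map_exp d (\<lambda>X. L X + complex_of_real (\<epsilon> n) \<cdot>\<^sub>m Q X) t X $$ (i,j)) \<longlonglongrightarrow> map_exp d L t X $$ (i,j)"
proof -
  define \<Lambda> where "\<Lambda> n = (\<lambda>X. L X + complex_of_real (\<epsilon> n) \<cdot>\<^sub>m Q X)" for n
  have \<Lambda>: "lin_map d d (\<Lambda> n)" for n unfolding \<Lambda>_def by (intro lin_map_add lin_map_smult L Q)
  have \<Lambda>_app: "\<Lambda> n Y = L Y + complex_of_real (\<epsilon> n) \<cdot>\<^sub>m Q Y" for n Y by (simp add: \<Lambda>_def)
  obtain C where C: "entry_bound d C L" using lin_map_entry_bound[OF L] .
  obtain C' where C': "entry_bound d C' Q" using lin_map_entry_bound[OF Q] .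
  have bound: "entry_bound d (C + C') (\<Lambda> n)" for n
    unfolding \<Lambda>_def by (rule entry_bound_perturb[OF L C Q C' \<epsilon>(1,2)])
  obtain B where B: "\<forall>i<d. \<forall>j<d. norm (X $$ (i,j)) \<le> B" using mat_entries_bounded[of d X] by (elim exE)
  have growth: "norm ((\<Lambda> n ^^ k) X $$ (i,j)) \<le> (C + C') ^ k * B" for n k
    by (rule entry_bound_funpow[OF \<Lambda> bound X B[rule_format] ij])
  have car: "(\<Lambda> n ^^ k) X \<in> carrier_mat d d" for n k by (rule lin_map_carrier[OF lin_map_funpow[OF \<Lambda>] X])
  have carL: "(L ^^ k) X \<in> carrier_mat d d" for k by (rule lin_map_carrier[OF lin_map_funpow[OF L] X])
  have lim: "(\<lambda>n. (\<Lambda> n ^^ k) X $$ (i,j)) \<longlonglongrightarrow> (L ^^ k) X $$ (i,j)" if "i < d" "j < d" for k i j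
    using that
  proof (induction k arbitrary: i j)
    case (Suc k)
    have "(\<lambda>n. L ((\<Lambda> n ^^ k) X) $$ (i,j) + complex_of_real (\<epsilon> n) * Q ((\<Lambda> n ^^ k) X) $$ (i,j))
        \<longlonglongrightarrow> L ((L ^^ k) X) $$ (i,j) + complex_of_real 0 * Q ((L ^^ k) X) $$ (i,j)"
      by (intro tendsto_add tendsto_mult tendsto_of_real \<epsilon>(3) lin_map_tendsto[OF L car carL]
          lin_map_tendsto[OF Q car carL] Suc)
    moreover have "(\<Lambda> n ^^ Suc k) X $$ (i,j) =
        L ((\<Lambda> n ^^ k) X) $$ (i,j) + complex_of_real (\<epsilon> n) * Q ((\<Lambda> n ^^ k) X) $$ (i,j)" for n
      using Suc.prems carrier_matD[OF lin_map_carrier[OF L car]] carrier_matD[OF lin_map_carrier[OF Q car]]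
      by (simp add: \<Lambda>_app)
    ultimately show ?case by (simp only: of_real_0 mult_zero_left add_0_right) simp
  qed simp
  \<comment> \<open>The outer norm makes the majorant nonnegative whatever the signs of
    \<open>t\<close>, \<open>C + C'\<close> and \<open>B\<close>; its summability is accordingly
    obtained with their absolute values.\<close>
  define M where "M k = norm (complex_of_real (t ^ k / fact k) * complex_of_real ((C + C') ^ k * B))" for k
  have "summable M" unfolding M_def
    by (rule exp_series_abs_summable[where C = "\<bar>C + C'\<bar>" and B = "\<bar>B\<bar>"]) (simp add: norm_mult norm_power del: of_real_add)
  moreover have "norm (complex_of_real (t ^ k / fact k) * (\<Lambda> n ^^ k) X $$ (i,j)) \<le> M k" for k n
    unfolding M_def norm_mult[of "complex_of_real (t ^ k / fact k)"]
    using growth[where n=n and k=k] by (intro mult_left_mono) (auto simp del: of_real_mult of_real_power)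
  moreover have "(\<lambda>n. complex_of_real (t ^ k / fact k) * (\<Lambda> n ^^ k) X $$ (i,j)) \<longlonglongrightarrow>
      complex_of_real (t ^ k / fact k) * (L ^^ k) X $$ (i,j)" for k
    by (intro tendsto_mult_left lim ij)
  ultimately have "(\<lambda>n. \<Sum>k. complex_of_real (t ^ k / fact k) * (\<Lambda> n ^^ k) X $$ (i,j)) \<longlonglongrightarrow>
      (\<Sum>k. complex_of_real (t ^ k / fact k) * (L ^^ k) X $$ (i,j))"
    by (intro tannerys_theorem[where M = M, THEN conjunct2, THEN conjunct2])
      (auto intro!: always_eventually simp del: of_real_divide of_real_power)
  then show ?thesis using ij by (simp add: map_exp_def \<Lambda>_def)
qed

text \<open>The approximation argument detached from the reduction. The linear map \<open>P\<close>
  exhibits \<open>A\<close> as a subspace closed under entrywise limits. The maps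
  \<open>M \<epsilon>\<close> are completely positive on the full space but agree with a perturbed
  Euler step only on \<open>A\<close>; they serve complete positivity, while the other semigroup
  properties come from the exponential series itself.\<close>

lemma qds_on_map_exp:
  assumes L: "lin_map d d L" and P: "lin_map d d P" and Q: "lin_map d d Q"
    and A: "A = {X \<in> carrier_mat d d. P X = X}"
    and LA: "\<And>X. X \<in> A \<Longrightarrow> L X \<in> A" and QA: "\<And>X. X \<in> A \<Longrightarrow> Q X \<in> A"
    and tr: "\<And>X. X \<in> A \<Longrightarrow> mtrace (L X) = 0"
    and M: "\<And>\<epsilon>. \<epsilon> > 0 \<Longrightarrow> cp_map d d (M \<epsilon>)"
    and M_eq: "\<And>\<epsilon> X. \<epsilon> > 0 \<Longrightarrow> X \<in> A \<Longrightarrow>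
      M \<epsilon> X = complex_of_real \<epsilon> \<cdot>\<^sub>m (L X + complex_of_real \<epsilon> \<cdot>\<^sub>m Q X) + X"
  shows "qds_on d A (map_exp d L)"
proof -
  have Ac: "A \<subseteq> carrier_mat d d" using A by auto
  have Alin: "c \<cdot>\<^sub>m X + Y \<in> A" if "X \<in> A" "Y \<in> A" for c X Y
    using that by (simp add: A lin_map_lin[OF P])
  have Aadd: "X + Y \<in> A" if "X \<in> A" "Y \<in> A" for X Y
    using that by (simp add: A lin_map_add_arg[OF P])
  have Asm: "c \<cdot>\<^sub>m X \<in> A" if "X \<in> A" for X c
    using that by (simp add: A lin_map_smult_arg[OF P])
  have inA: "map_exp d L t X \<in> A" if X: "X \<in> A" for t X
  proof -
    have cX: "X \<in> carrier_mat d d" using X Ac by auto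
    have PL: "P ((L ^^ n) X) = (L ^^ n) X" for n
      using funpow_invariant[of A L, OF LA X, of n] by (simp add: A)
    \<comment> \<open>Every term of the series is a fixed point, and \<open>P\<close> can be applied
      term by term.\<close>
    have "P (map_exp d L t X) = map_exp d L t X"
    proof (rule eq_matI)
      fix i j assume "i < dim_row (map_exp d L t X)" "j < dim_col (map_exp d L t X)"
      then have ij: "i < d" "j < d" by auto
      show "P (map_exp d L t X) $$ (i,j) = map_exp d L t X $$ (i,j)"
        using lin_map_map_exp_sums[OF L cX P ij, of t] map_exp_sums[OF L cX ij, of t]
        unfolding PL by (rule sums_unique2)
    qed (use lin_map_carrier[OF P map_exp_carrier] in auto)
    then show ?thesis by (simp add: A)
  qed
  have pos: "pos_blocks m d (\<lambda>a b. map_exp d L t (X a b))"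
    if X: "\<And>a b. a < m \<Longrightarrow> b < m \<Longrightarrow> X a b \<in> A" and pos: "pos_blocks m d X" and t: "t \<ge> 0" for m X t
    unfolding pos_blocks_def
  proof
    fix v
    have cX: "X a b \<in> carrier_mat d d" if "a < m" "b < m" for a b using X that Ac by auto
    \<comment> \<open>Any null sequence in the interval from 0 (excluded) to 1 would do: positivity
      is for division by it, the bound 1 for the uniform majorant.\<close>
    define \<epsilon> where "\<epsilon> n = inverse (real (Suc n))" for n
    have \<epsilon>: "0 < \<epsilon> n" "0 \<le> \<epsilon> n" "\<epsilon> n \<le> 1" "\<epsilon> \<longlonglongrightarrow> 0" for n
      using LIMSEQ_inverse_real_of_nat by (auto simp: \<epsilon>_def[abs_def] inverse_le_1_iff)
    define \<Lambda> where "\<Lambda> n = (\<lambda>X. L X + complex_of_real (\<epsilon> n) \<cdot>\<^sub>m Q X)" for n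
    have \<Lambda>: "lin_map d d (\<Lambda> n)" for n unfolding \<Lambda>_def by (intro lin_map_add lin_map_smult L Q)
    have \<Lambda>A: "\<Lambda> n X \<in> A" if "X \<in> A" for n X
      unfolding \<Lambda>_def by (intro Aadd Asm LA QA that)
    have M\<Lambda>: "M (\<epsilon> n) X = complex_of_real (\<epsilon> n) \<cdot>\<^sub>m \<Lambda> n X + X" if "X \<in> A" for n X
      using M_eq[OF \<epsilon>(1) that] by (simp add: \<Lambda>_def)
    have MA: "M (\<epsilon> n) X \<in> A" if "X \<in> A" for n X
      using that by (simp add: M\<Lambda> Alin \<Lambda>A)
    have "(\<lambda>n. quad m d (\<lambda>a b. map_exp d (\<Lambda> n) t (X a b)) v) \<longlonglongrightarrow> quad m d (\<lambda>a b. map_exp d L t (X a b)) v"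
      unfolding \<Lambda>_def by (intro quad_tendsto map_exp_perturb_tendsto L Q cX \<epsilon>)
    then show "quad m d (\<lambda>a b. map_exp d L t (X a b)) v \<in> \<real>\<^sub>\<ge>\<^sub>0"
    proof (rule nonneg_Reals_tendsto)
      fix n
      \<comment> \<open>Cancelling \<open>exp (t / \<epsilon> n)\<close> presents the perturbed
        semigroup as a positive multiple of the exponential of a completely positive map.\<close>
      have "complex_of_real (exp (- (t / \<epsilon> n))) * map_exp d (M (\<epsilon> n)) (t / \<epsilon> n) (X a b) $$ (i,j) =
          map_exp d (\<Lambda> n) t (X a b) $$ (i,j)" if "a < m" "b < m" "i < d" "j < d" for a b i j
        using map_exp_id_plus[OF \<Lambda> cp_map_lin[OF M[OF \<epsilon>(1)]] Ac \<Lambda>A MA M\<Lambda> \<epsilon>(1) X[OF that(1,2)] that(3,4), of n t]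
        by (simp add: mult.assoc[symmetric] of_real_mult[symmetric] exp_add[symmetric] del: of_real_mult)
      then have "quad m d (\<lambda>a b. map_exp d (\<Lambda> n) t (X a b)) v =
          complex_of_real (exp (- (t / \<epsilon> n))) * quad m d (\<lambda>a b. map_exp d (M (\<epsilon> n)) (t / \<epsilon> n) (X a b)) v"
        unfolding quad_def sum_distrib_left by (intro sum.cong refl) (simp add: mult_ac)
      moreover have "pos_blocks m d (\<lambda>a b. map_exp d (M (\<epsilon> n)) (t / \<epsilon> n) (X a b))"
        using t \<epsilon>(2)[of n] by (intro pos_blocks_map_exp M[OF \<epsilon>(1)] cX pos) auto
      ultimately show "quad m d (\<lambda>a b. map_exp d (\<Lambda> n) t (X a b)) v \<in> \<real>\<^sub>\<ge>\<^sub>0"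
        by (simp only: pos_blocks_def nonneg_Reals_mult_I nonneg_Reals_of_real_iff exp_ge_zero)
    qed
  qed
  show ?thesis unfolding qds_on_def
  proof (intro conjI allI ballI impI)
    fix t :: real assume t: "0 \<le> t"
    show "cptp_on d A (map_exp d L t)" unfolding cptp_on_def
    proof (intro conjI ballI)
      show "linear_on A (map_exp d L t)"
        unfolding linear_on_def using Ac by (auto intro!: lin_map_lin[OF lin_map_map_exp[OF L]])
      show "completely_positive_on d A (map_exp d L t)"
        unfolding completely_positive_on_def psd_block_mat_iff using pos[OF _ _ t] by blast
      fix X assume X: "X \<in> A"
      then show "map_exp d L t X \<in> A" by (rule inA)
      have "mtrace ((L ^^ Suc k) X) = 0" for k
        using tr[OF funpow_invariant[of A L, OF LA X, of k]] by simp
      then show "mtrace (map_exp d L t X) = mtrace X"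
        using mtrace_map_exp[OF L] X Ac by auto
    qed
  qed (use Ac in \<open>auto intro: map_exp_0 map_exp_add[OF L] continuous_on_map_exp[OF L]\<close>)
qed

section \<open>Building blocks of the reduction\<close>

lemma sum_lessThan_add:
  fixes f :: "nat \<Rightarrow> 'a::comm_monoid_add"
  shows "(\<Sum>i<m + n. f i) = (\<Sum>i<m. f i) + (\<Sum>i<n. f (m + i))"
  by (induction n) (simp_all add: add.assoc)

section \<open>Cholesky factorisation of a positive kernel\<close>

lemma quad_form_Suc:
  fixes t :: "nat \<Rightarrow> nat \<Rightarrow> complex"
  shows "(\<Sum>i<Suc g. \<Sum>j<Suc g. cnj (v i) * t i j * v j) =
    (\<Sum>i<g. \<Sum>j<g. cnj (v i) * t i j * v j) + cnj (v g) * (\<Sum>j<g. t g j * v j)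
      + (\<Sum>i<g. cnj (v i) * t i g) * v g + cnj (v g) * t g g * v g"
  by (simp add: sum.distrib sum_distrib_left sum_distrib_right algebra_simps)

text \<open>Cholesky factorisation. Where the pivot \<open>t g g\<close> vanishes, so does its row, and the junk value
  of division by zero makes the same formulas valid.\<close>
lemma psd_kernel_factorization:
  fixes t :: "nat \<Rightarrow> nat \<Rightarrow> complex"
  assumes "\<And>v. (\<Sum>i<g. \<Sum>j<g. cnj (v i) * t i j * v j) \<in> \<real>\<^sub>\<ge>\<^sub>0"
  shows "\<exists>w. \<forall>i<g. \<forall>j<g. t i j = (\<Sum>r<g. w r i * cnj (w r j))"
  using assms
proof (induction g arbitrary: t)
  case (Suc g)
  note pos = Suc.prems[unfolded quad_form_Suc]
  have c: "t g g \<in> \<real>\<^sub>\<ge>\<^sub>0" using pos[of "\<lambda>j. if j = g then 1 else 0"] by simp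
  then obtain cr where cr: "t g g = complex_of_real cr" "0 \<le> cr" by (auto elim: nonneg_Reals_cases)
  \<comment> \<open>The test vector has entry 1 at position \<open>i\<close>, entry \<open>y\<close>
    at the pivot position \<open>g\<close>, and 0 elsewhere.\<close>
  have two: "t i i + cnj y * t g i + t i g * y + cnj y * t g g * y \<in> \<real>\<^sub>\<ge>\<^sub>0" if "i < g" for i y
  proof -
    define v where "v j = (if j = g then y else if j = i then 1 else 0)" for j
    have v: "v j = (if j = i then 1 else 0)" if "j < g" for j using that by (simp add: v_def)
    have vg: "v g = y" by (simp add: v_def)
    have "(\<Sum>i<g. \<Sum>j<g. cnj (v i) * t i j * v j) = (\<Sum>k<g. if k = i then (\<Sum>j<g. if j = i then t k j else 0) else 0)"
      by (intro sum.cong refl) (auto simp: v intro!: sum.cong simp del: sum.delta sum.delta')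
    also have "\<dots> = t i i" using that by simp
    finally have 1: "(\<Sum>i<g. \<Sum>j<g. cnj (v i) * t i j * v j) = t i i" .
    have "(\<Sum>j<g. t g j * v j) = (\<Sum>j<g. if j = i then t g j else 0)" by (intro sum.cong refl) (auto simp: v)
    then have 2: "(\<Sum>j<g. t g j * v j) = t g i" using that by simp
    have "(\<Sum>k<g. cnj (v k) * t k g) = (\<Sum>k<g. if k = i then t k g else 0)" by (intro sum.cong refl) (auto simp: v)
    then have 3: "(\<Sum>k<g. cnj (v k) * t k g) = t i g" using that by simp
    show ?thesis using pos[of v] by (simp only: 1 2 3 vg)
  qed
  \<comment> \<open>Polarisation: the imaginary part of the form vanishes at \<open>y = 0\<close>,
    \<open>y = 1\<close> and \<open>y = \<i>\<close>, which pins down both parts of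
    \<open>t i g\<close>.\<close>
  have herm: "t i g = cnj (t g i)" if "i < g" for i
  proof -
    have "Im (t i i) = 0" using two[OF that, of 0] by (simp add: complex_nonneg_Reals_iff)
    then show ?thesis using two[OF that, of 1] two[OF that, of \<i>]
      by (simp add: complex_nonneg_Reals_iff complex_eq_iff cr(1))
  qed
  have zero: "t g i = 0" if "i < g" "cr = 0" for i
  proof (rule ccontr)
    assume ne: "t g i \<noteq> 0"
    \<comment> \<open>With a zero pivot the form is affine along \<open>y = - s * t g i\<close>.
      This \<open>s\<close> makes its value \<open>Re (t i i) - 2 * (Re (t i i) + 1)\<close>, which
      is negative.\<close>
    define s where "s = (Re (t i i) + 1) / (norm (t g i))\<^sup>2"
    have n2: "t g i * cnj (t g i) = complex_of_real ((norm (t g i))\<^sup>2)"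
      by (rule complex_norm_square[symmetric])
    have s: "s * (norm (t g i))\<^sup>2 = Re (t i i) + 1" using ne by (simp add: s_def)
    have "Re (t i i) \<ge> 0" using two[OF that(1), of 0] by (simp add: complex_nonneg_Reals_iff)
    have "cnj (- complex_of_real s * t g i) * t g i = - complex_of_real (s * (norm (t g i))\<^sup>2)"
      using n2 by (simp add: mult.commute mult.left_commute)
    moreover have "t i g * (- complex_of_real s * t g i) = - complex_of_real (s * (norm (t g i))\<^sup>2)"
      using n2 by (simp add: herm[OF that(1)] mult.commute mult.left_commute)
    moreover have "t i i + cnj y * t g i + t i g * y \<in> \<real>\<^sub>\<ge>\<^sub>0" for y
      using two[OF that(1), of y] that(2) cr(1) by simp
    ultimately have "t i i + - complex_of_real (s * (norm (t g i))\<^sup>2) + - complex_of_real (s * (norm (t g i))\<^sup>2) \<in> \<real>\<^sub>\<ge>\<^sub>0"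
      by metis
    then have "Re (t i i) - 2 * (Re (t i i) + 1) \<ge> 0" unfolding s by (simp add: complex_nonneg_Reals_iff)
    with \<open>Re (t i i) \<ge> 0\<close> show False by simp
  qed
  \<comment> \<open>The Schur complement of the pivot, on which the induction hypothesis is
    used.\<close>
  define t' where "t' i j = t i j - t i g * t g j / t g g" for i j
  have "(\<Sum>i<g. \<Sum>j<g. cnj (v i) * t' i j * v j) \<in> \<real>\<^sub>\<ge>\<^sub>0" for v
  proof -
    define \<alpha> where "\<alpha> = (\<Sum>j<g. t g j * v j)"
    have \<beta>: "(\<Sum>i<g. cnj (v i) * t i g) = cnj \<alpha>"
      by (simp add: \<alpha>_def herm mult.commute)
    \<comment> \<open>For a nonzero pivot this last coordinate minimises the form with the others
      fixed, and the minimum is the form of the Schur complement.\<close>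
    define u where "u = v(g := - \<alpha> / t g g)"
    have u: "u i = v i" if "i < g" for i using that by (simp add: u_def)
    have ug: "u g = - \<alpha> / t g g" by (simp add: u_def)
    have "(\<Sum>i<g. \<Sum>j<g. cnj (v i) * t' i j * v j) =
        (\<Sum>i<g. \<Sum>j<g. cnj (v i) * t i j * v j) - (\<Sum>i<g. \<Sum>j<g. (cnj (v i) * t i g) * (t g j * v j)) / t g g"
      unfolding sum_divide_distrib sum_subtractf[symmetric]
      by (intro sum.cong refl) (simp add: t'_def algebra_simps)
    also have "(\<Sum>i<g. \<Sum>j<g. (cnj (v i) * t i g) * (t g j * v j)) = cnj \<alpha> * \<alpha>"
      by (simp only: sum_product[symmetric] \<beta> \<alpha>_def[symmetric])
    finally have 1: "(\<Sum>i<g. \<Sum>j<g. cnj (v i) * t' i j * v j) =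
        (\<Sum>i<g. \<Sum>j<g. cnj (v i) * t i j * v j) - cnj \<alpha> * \<alpha> / t g g" .
    have 2: "(\<Sum>i<g. \<Sum>j<g. cnj (v i) * t i j * v j) + cnj (u g) * \<alpha> + cnj \<alpha> * u g + cnj (u g) * t g g * u g \<in> \<real>\<^sub>\<ge>\<^sub>0"
      using pos[of u] by (simp add: u \<alpha>_def[symmetric] \<beta>)
    have "cnj (u g) * \<alpha> + cnj \<alpha> * u g + cnj (u g) * t g g * u g = - (cnj \<alpha> * \<alpha> / t g g)"
      unfolding ug by (cases "cr = 0") (auto simp: cr(1) field_simps)
    then show ?thesis using 1 2 by (simp add: add.assoc)
  qed
  from Suc.IH[OF this] obtain w' where w': "\<forall>i<g. \<forall>j<g. t' i j = (\<Sum>r<g. w' r i * cnj (w' r j))" by blast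
  \<comment> \<open>The index \<open>r = g\<close> carries the pivot column scaled by the square
    root of the pivot; it accounts for what the Schur complement subtracted. The earlier vectors are
    extended by 0 at \<open>g\<close>.\<close>
  define w where "w r i = (if r = g then t i g / complex_of_real (sqrt cr) else if i = g then 0 else w' r i)" for r i
  have sq: "complex_of_real (sqrt cr) * complex_of_real (sqrt cr) = complex_of_real cr"
    using cr(2) by (simp flip: of_real_mult)
  have "t i j = (\<Sum>r<Suc g. w r i * cnj (w r j))" if ij: "i < Suc g" "j < Suc g" for i j
  proof -
    have row: "t g k * complex_of_real cr / complex_of_real cr = t g k" if "k < g" for k
      using zero[OF that] by auto
    consider "i < g" "j < g" | "i = g" "j < g" | "i < g" "j = g" | "i = g" "j = g" using ij by (auto simp: less_Suc_eq)
    then show ?thesis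
    proof cases
      case 1
      have "(\<Sum>r<g. w r i * cnj (w r j)) = t' i j" using w' 1 by (simp add: w_def)
      moreover have "w g i * cnj (w g j) = t i g * t g j / t g g"
        using 1 sq by (simp add: w_def herm cr(1))
      ultimately show ?thesis by (simp add: t'_def)
    next
      case 2
      then show ?thesis using sq row[of j] by (simp add: w_def herm cr(1) mult.commute)
    next
      case 3
      then show ?thesis using sq zero[of i] by (auto simp: w_def herm cr(1))
    next
      case 4
      then show ?thesis using sq by (simp add: w_def cr(1))
    qed
  qed
  then show ?case by blast
qed simp

text \<open>Decomposing \<open>T\<close> into rank-one terms supplies the Kraus operators for
  tensoring with \<open>T\<close>.\<close>

lemma psd_factorization:
  assumes "psd g T"
  shows "\<exists>w. \<forall>i<g. \<forall>j<g. T $$ (i,j) = (\<Sum>r<g. w r i * cnj (w r j))"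
proof (rule psd_kernel_factorization)
  fix v :: "nat \<Rightarrow> complex"
  have T: "T \<in> carrier_mat g g" using assms by (simp add: psd_def)
  obtain r where r: "r \<ge> 0" "(\<Sum>i<g. cnj (vec g v $ i) * (T *\<^sub>v vec g v) $ i) = complex_of_real r"
    using assms unfolding psd_def by (metis vec_carrier)
  have "(\<Sum>i<g. cnj (vec g v $ i) * (T *\<^sub>v vec g v) $ i) = (\<Sum>i<g. \<Sum>j<g. cnj (v i) * T $$ (i,j) * v j)"
    using T by (intro sum.cong refl)
      (auto simp: scalar_prod_def sum_distrib_left lessThan_atLeast0 mult.assoc intro!: sum.cong)
  then show "(\<Sum>i<g. \<Sum>j<g. cnj (v i) * T $$ (i,j) * v j) \<in> \<real>\<^sub>\<ge>\<^sub>0"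
    using r by simp
qed

section \<open>Complete positivity of tensoring, partial trace, compression and direct sum\<close>

lemma kron_carrier: "A \<in> carrier_mat f f \<Longrightarrow> B \<in> carrier_mat g g \<Longrightarrow> kron A B \<in> carrier_mat (f * g) (f * g)"
  by (auto simp: kron_def)

lemma div_less_of_mult: "i < f * (g::nat) \<Longrightarrow> i div g < f"
  by (simp add: less_mult_imp_div_less)

lemma mod_less_of_mult: "i < f * (g::nat) \<Longrightarrow> i mod g < g"
  by (cases "g = 0") auto

text \<open>If \<open>T\<close> is the sum of the rank-one matrices of vectors \<open>w r\<close>,
  the Kraus operators are the isometry-like maps sending \<open>x\<close> to \<open>x\<close> tensor
  \<open>w r\<close>. The index \<open>i\<close> of the product encodes the pair
  \<open>i div g\<close>, \<open>i mod g\<close>.\<close>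

lemma cp_map_kron:
  assumes "psd g T"
  shows "cp_map f (f * g) (\<lambda>X. kron X T)"
proof -
  have T: "T \<in> carrier_mat g g" using assms by (simp add: psd_def)
  obtain w where w: "\<forall>i<g. \<forall>j<g. T $$ (i,j) = (\<Sum>r<g. w r i * cnj (w r j))"
    using psd_factorization[OF assms] by blast
  show ?thesis
  proof (rule cp_mapI_kraus[where F = "{..<g}" and V = "\<lambda>r i k. if k = i div g then w r (i mod g) else 0"])
    fix X :: "complex mat" and i j
    assume X: "X \<in> carrier_mat f f" and ij: "i < f * g" "j < f * g"
    have "(\<Sum>r<g. \<Sum>k<f. \<Sum>l<f. (if k = i div g then w r (i mod g) else 0) * X $$ (k,l) *
        cnj (if l = j div g then w r (j mod g) else 0))
      = (\<Sum>r<g. \<Sum>k<f. if k = i div g then (\<Sum>l<f. if l = j div g then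
          w r (i mod g) * X $$ (k,l) * cnj (w r (j mod g)) else 0) else 0)"
      by (intro sum.cong refl) (auto intro!: sum.cong simp del: sum.delta sum.delta')
    also have "\<dots> = (\<Sum>r<g. w r (i mod g) * X $$ (i div g, j div g) * cnj (w r (j mod g)))"
      using div_less_of_mult[OF ij(1)] div_less_of_mult[OF ij(2)] by simp
    also have "\<dots> = X $$ (i div g, j div g) * T $$ (i mod g, j mod g)"
      using w mod_less_of_mult[OF ij(1)] mod_less_of_mult[OF ij(2)] by (simp add: sum_distrib_left mult_ac)
    finally show "kron X T $$ (i,j) = (\<Sum>r<g. \<Sum>k<f. \<Sum>l<f. (if k = i div g then w r (i mod g) else 0) * X $$ (k,l) *
        cnj (if l = j div g then w r (j mod g) else 0))"
      using X T ij by (simp add: kron_def)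
  qed (use T in \<open>simp add: kron_carrier\<close>)
qed

text \<open>Here each Kraus operator has a single 1 in every row, so conjugation merely picks
  entries. Partial trace and compression to a diagonal block are both of this kind.\<close>

lemma cp_mapI_selection:
  assumes carr: "\<And>X. X \<in> carrier_mat d d \<Longrightarrow> \<Phi> X \<in> carrier_mat d' d'"
    and less: "\<And>r i. r \<in> F \<Longrightarrow> i < d' \<Longrightarrow> s r i < d"
    and entry: "\<And>X i j. X \<in> carrier_mat d d \<Longrightarrow> i < d' \<Longrightarrow> j < d' \<Longrightarrow> \<Phi> X $$ (i,j) = (\<Sum>r\<in>F. X $$ (s r i, s r j))"
  shows "cp_map d d' \<Phi>"
proof (rule cp_mapI_kraus[where F = F and V = "\<lambda>r i k. if k = s r i then 1 else 0"])
  fix X :: "complex mat" and i j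
  assume X: "X \<in> carrier_mat d d" and ij: "i < d'" "j < d'"
  have "(\<Sum>r\<in>F. \<Sum>k<d. \<Sum>l<d. (if k = s r i then 1 else 0) * X $$ (k,l) * cnj (if l = s r j then 1 else 0))
      = (\<Sum>r\<in>F. \<Sum>k<d. if k = s r i then (\<Sum>l<d. if l = s r j then X $$ (k,l) else 0) else 0)"
    by (intro sum.cong refl) (auto intro!: sum.cong simp del: sum.delta sum.delta')
  also have "\<dots> = (\<Sum>r\<in>F. X $$ (s r i, s r j))"
    using less ij by (intro sum.cong refl) simp
  finally show "\<Phi> X $$ (i,j) = (\<Sum>r\<in>F. \<Sum>k<d. \<Sum>l<d.
      (if k = s r i then 1 else 0) * X $$ (k,l) * cnj (if l = s r j then 1 else 0))"
    by (simp add: entry[OF X ij])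
qed (rule carr)

lemma cp_map_ptrace2: "cp_map (f * g) f (ptrace2 f g)"
  by (rule cp_mapI_selection[where F = "{..<g}" and s = "\<lambda>r i. i * g + r"]) (auto simp: ptrace2_def offset_less)

lemma cp_map_diag_block: "off + s \<le> d \<Longrightarrow> cp_map d s (diag_block off s)"
  by (rule cp_mapI_selection[where F = "{()}" and s = "\<lambda>_ i. off + i"]) (auto simp: diag_block_def)

text \<open>The zero off-diagonal blocks remove all mixed terms, so the form splits into one form
  for each summand. The argument works with forms because \<open>\<Phi>\<close> and
  \<open>\<Psi>\<close> come without Kraus operators.\<close>

lemma cp_map_direct_sum:
  assumes \<Phi>: "cp_map d d1 \<Phi>" and \<Psi>: "cp_map d d2 \<Psi>"
  shows "cp_map d (d1 + d2) (\<lambda>X. four_block_mat (\<Phi> X) (0\<^sub>m (dim_row (\<Phi> X)) (dim_col (\<Psi> X)))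
    (0\<^sub>m (dim_row (\<Psi> X)) (dim_col (\<Phi> X))) (\<Psi> X))" (is "cp_map _ _ ?D")
  unfolding cp_map_def
proof (intro conjI allI impI)
  have c: "\<Phi> X \<in> carrier_mat d1 d1" "\<Psi> X \<in> carrier_mat d2 d2" if "X \<in> carrier_mat d d" for X
    using lin_map_carrier[OF cp_map_lin[OF \<Phi>] that] lin_map_carrier[OF cp_map_lin[OF \<Psi>] that] by auto
  show "lin_map d (d1 + d2) ?D"
  proof (rule lin_mapI)
    fix X Y :: "complex mat" and b assume X: "X \<in> carrier_mat d d" and Y: "Y \<in> carrier_mat d d"
    note [simp] = carrier_matD[OF c(1)[OF X]] carrier_matD[OF c(2)[OF X]]
      carrier_matD[OF c(1)[OF Y]] carrier_matD[OF c(2)[OF Y]]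
    show "?D (b \<cdot>\<^sub>m X + Y) = b \<cdot>\<^sub>m ?D X + ?D Y"
      unfolding lin_map_lin[OF cp_map_lin[OF \<Phi>] X Y] lin_map_lin[OF cp_map_lin[OF \<Psi>] X Y]
      by (rule eq_matI) auto
  qed (use c in auto)
  fix m X assume X: "\<forall>a<m. \<forall>b<m. X a b \<in> carrier_mat d d" and pos: "pos_blocks m d X"
  have "quad m (d1 + d2) (\<lambda>a b. ?D (X a b)) v =
      quad m d1 (\<lambda>a b. \<Phi> (X a b)) v + quad m d2 (\<lambda>a b. \<Psi> (X a b)) (\<lambda>a i. v a (d1 + i))" for v
    unfolding quad_def sum.distrib[symmetric]
  proof (intro sum.cong refl, goal_cases)
    case (1 a b)
    then have "X a b \<in> carrier_mat d d" using X by auto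
    note [simp] = carrier_matD[OF c(1)[OF this]] carrier_matD[OF c(2)[OF this]]
    show ?case by (simp add: sum_lessThan_add)
  qed
  then show "pos_blocks m (d1 + d2) (\<lambda>a b. ?D (X a b))"
    using cp_map_pos[OF \<Phi> _ pos] cp_map_pos[OF \<Psi> _ pos] X by (simp add: pos_blocks_def)
qed

lemma cp_map_bdiag:
  assumes "\<And>k. k \<in> set ks \<Longrightarrow> cp_map d (e k) (\<Phi> k)"
  shows "cp_map d (sum_list (map e ks)) (\<lambda>X. bdiag (map (\<lambda>k. \<Phi> k X) ks))"
  using assms
proof (induction ks)
  case Nil
  \<comment> \<open>The image is the 0 by 0 matrix, so the entry condition is vacuous and the empty
    Kraus family serves.\<close>
  show ?case by (rule cp_mapI_kraus[where F = "{}"]) auto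
next
  case (Cons k ks)
  then show ?case using cp_map_direct_sum[of d "e k" "\<Phi> k"] by simp
qed

section \<open>Lindblad generators\<close>

lemma adj_add: "A \<in> carrier_mat r c \<Longrightarrow> B \<in> carrier_mat r c \<Longrightarrow> adj (A + B) = adj A + adj B"
  by (rule eq_matI) auto

lemma adj_smult: "adj (c \<cdot>\<^sub>m A) = cnj c \<cdot>\<^sub>m adj A"
  by (rule eq_matI) auto

lemma adj_mult:
  assumes "A \<in> carrier_mat r c" "B \<in> carrier_mat c s"
  shows "adj (A * B) = adj B * adj A"
  by (rule eq_matI)
    (use assms in \<open>auto simp: index_mult_mat_sum mult.commute simp del: index_mult_mat(1)\<close>)

lemma adj_adj [simp]: "adj (adj A) = A"
  by (rule eq_matI) auto

lemma adj_one [simp]: "adj (1\<^sub>m n) = 1\<^sub>m n"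
  by (rule eq_matI) auto

lemma mtrace_add: "A \<in> carrier_mat n n \<Longrightarrow> B \<in> carrier_mat n n \<Longrightarrow> mtrace (A + B) = mtrace A + mtrace B"
  by (auto simp: mtrace_def sum.distrib)

lemma mtrace_diff: "A \<in> carrier_mat n n \<Longrightarrow> B \<in> carrier_mat n n \<Longrightarrow> mtrace (A - B) = mtrace A - mtrace B"
  by (auto simp: mtrace_def sum_subtractf)

lemma mtrace_smult: "A \<in> carrier_mat n n \<Longrightarrow> mtrace (c \<cdot>\<^sub>m A) = c * mtrace A"
  by (auto simp: mtrace_def sum_distrib_left)

lemma mtrace_mult_commute:
  assumes "A \<in> carrier_mat n m" "B \<in> carrier_mat m n"
  shows "mtrace (A * B) = mtrace (B * A)"
proof -
  have "mtrace (A * B) = (\<Sum>i<n. \<Sum>k<m. A $$ (i,k) * B $$ (k,i))"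
    using assms by (auto simp: mtrace_def index_mult_mat_sum simp del: index_mult_mat(1))
  also have "\<dots> = (\<Sum>k<m. \<Sum>i<n. B $$ (k,i) * A $$ (i,k))"
    by (subst sum.swap) (simp add: mult.commute)
  also have "\<dots> = mtrace (B * A)"
    using assms by (auto simp: mtrace_def index_mult_mat_sum simp del: index_mult_mat(1))
  finally show ?thesis .
qed

text \<open>Since \<open>adj K * K\<close> is self-adjoint, half of the anticommutator falls to each
  side, and the jump operator \<open>K\<close> contributes
  \<open>(-1/2) \<cdot>\<^sub>m (adj K * K)\<close> to \<open>G\<close>.\<close>

lemma dissipator_split:
  assumes K: "K \<in> carrier_mat n n" and \<rho>: "\<rho> \<in> carrier_mat n n"
  shows "K * \<rho> * adj K - (1/2) \<cdot>\<^sub>m anticommutator (adj K * K) \<rho> =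
    K * \<rho> * adj K + (((-1/2) \<cdot>\<^sub>m (adj K * K)) * \<rho> + \<rho> * adj ((-1/2) \<cdot>\<^sub>m (adj K * K)))"
proof -
  have KK: "adj K * K \<in> carrier_mat n n" using K by auto
  have 1: "((-1/2) \<cdot>\<^sub>m (adj K * K)) * \<rho> = (-1/2) \<cdot>\<^sub>m (adj K * K * \<rho>)"
    by (rule mult_smult_assoc_mat[OF KK \<rho>])
  have 2: "adj ((-1/2) \<cdot>\<^sub>m (adj K * K)) = (-1/2) \<cdot>\<^sub>m (adj K * K)"
    using adj_mult[OF adj_carrier[OF K] K] by (simp add: adj_smult)
  have 3: "\<rho> * ((-1/2) \<cdot>\<^sub>m (adj K * K)) = (-1/2) \<cdot>\<^sub>m (\<rho> * (adj K * K))"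
    by (rule mult_smult_distrib[OF \<rho> KK])
  have "A - (1/2) \<cdot>\<^sub>m (B + C) = A + ((-1/2) \<cdot>\<^sub>m B + (-1/2) \<cdot>\<^sub>m C)"
    if "A \<in> carrier_mat n n" "B \<in> carrier_mat n n" "C \<in> carrier_mat n n" for A B C :: "complex mat"
    using that by (intro eq_matI) (auto simp: field_simps)
  from this[OF mult_carrier_mat[OF mult_carrier_mat[OF K \<rho>] adj_carrier[OF K]] mult_carrier_mat[OF KK \<rho>]
      mult_carrier_mat[OF \<rho> KK]]
  show ?thesis unfolding anticommutator_def 1 2 3 .
qed

lemma commutator_split:
  assumes H: "H \<in> carrier_mat n n" "hermitian_mat H" and \<rho>: "\<rho> \<in> carrier_mat n n"
  shows "(- \<i>) \<cdot>\<^sub>m commutator H \<rho> = ((- \<i>) \<cdot>\<^sub>m H) * \<rho> + \<rho> * adj ((- \<i>) \<cdot>\<^sub>m H)"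
proof -
  have 1: "adj ((- \<i>) \<cdot>\<^sub>m H) = \<i> \<cdot>\<^sub>m H" using H(2) by (simp add: adj_smult hermitian_mat_def)
  have 2: "((- \<i>) \<cdot>\<^sub>m H) * \<rho> = (- \<i>) \<cdot>\<^sub>m (H * \<rho>)" by (rule mult_smult_assoc_mat[OF H(1) \<rho>])
  have 3: "\<rho> * (\<i> \<cdot>\<^sub>m H) = \<i> \<cdot>\<^sub>m (\<rho> * H)" by (rule mult_smult_distrib[OF \<rho> H(1)])
  have "(- \<i>) \<cdot>\<^sub>m (B - C) = (- \<i>) \<cdot>\<^sub>m B + \<i> \<cdot>\<^sub>m C"
    if "B \<in> carrier_mat n n" "C \<in> carrier_mat n n" for B C :: "complex mat"
    using that by (intro eq_matI) (auto simp: algebra_simps)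
  from this[OF mult_carrier_mat[OF H(1) \<rho>] mult_carrier_mat[OF \<rho> H(1)]]
  show ?thesis unfolding commutator_def 1 2 3 .
qed

lemma cp_map_zero: "cp_map d d' (\<lambda>_. 0\<^sub>m d' d')"
  by (rule cp_mapI_kraus[where F = "{}"]) auto

text \<open>Recording that the trace is annihilated replaces the usual relation between
  \<open>G + adj G\<close> and the dual of \<open>\<Psi>\<close>, so no dual map is needed and
  generators can be assembled summand by summand.\<close>

definition gksl_form :: "nat \<Rightarrow> (complex mat \<Rightarrow> complex mat) \<Rightarrow> bool" where
  "gksl_form n \<L> \<longleftrightarrow> (\<exists>G \<Psi>. G \<in> carrier_mat n n \<and> cp_map n n \<Psi> \<and>
     (\<forall>\<rho>\<in>carrier_mat n n. \<L> \<rho> = \<Psi> \<rho> + (G * \<rho> + \<rho> * adj G) \<and> mtrace (\<L> \<rho>) = 0))"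

lemma gksl_form_add:
  assumes "gksl_form n \<L>" "gksl_form n \<K>"
  shows "gksl_form n (\<lambda>\<rho>. \<L> \<rho> + \<K> \<rho>)"
proof -
  obtain G \<Psi> where 1: "G \<in> carrier_mat n n" "cp_map n n \<Psi>"
    "\<forall>\<rho>\<in>carrier_mat n n. \<L> \<rho> = \<Psi> \<rho> + (G * \<rho> + \<rho> * adj G) \<and> mtrace (\<L> \<rho>) = 0"
    using assms(1) unfolding gksl_form_def by (elim exE conjE)
  obtain G' \<Psi>' where 2: "G' \<in> carrier_mat n n" "cp_map n n \<Psi>'"
    "\<forall>\<rho>\<in>carrier_mat n n. \<K> \<rho> = \<Psi>' \<rho> + (G' * \<rho> + \<rho> * adj G') \<and> mtrace (\<K> \<rho>) = 0"
    using assms(2) unfolding gksl_form_def by (elim exE conjE)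
  show ?thesis unfolding gksl_form_def
  proof (intro exI conjI ballI)
    show "G + G' \<in> carrier_mat n n" using 1 2 by auto
    \<comment> \<open>The coefficient 1 only brings the sum into the shape of
      \<open>cp_map_lincomb\<close>.\<close>
    show "cp_map n n (\<lambda>\<rho>. 1 \<cdot>\<^sub>m \<Psi> \<rho> + \<Psi>' \<rho>)" by (intro cp_map_lincomb 1 2) simp
    fix \<rho> :: "complex mat" assume \<rho>: "\<rho> \<in> carrier_mat n n"
    have c: "\<Psi> \<rho> \<in> carrier_mat n n" "\<Psi>' \<rho> \<in> carrier_mat n n"
      using lin_map_carrier[OF cp_map_lin \<rho>] 1 2 by auto
    have d: "G * \<rho> \<in> carrier_mat n n" "G' * \<rho> \<in> carrier_mat n n"
      "\<rho> * adj G \<in> carrier_mat n n" "\<rho> * adj G' \<in> carrier_mat n n" using 1(1) 2(1) \<rho> by auto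
    have e: "(G + G') * \<rho> = G * \<rho> + G' * \<rho>" by (rule add_mult_distrib_mat[OF 1(1) 2(1) \<rho>])
    have f: "\<rho> * adj (G + G') = \<rho> * adj G + \<rho> * adj G'"
      unfolding adj_add[OF 1(1) 2(1)] by (rule mult_add_distrib_mat[OF \<rho>]) (use 1 2 in auto)
    note L1 = conjunct1[OF bspec[OF 1(3) \<rho>]] and L2 = conjunct1[OF bspec[OF 2(3) \<rho>]]
    have "A + (B + C) + (A' + (B' + C')) = 1 \<cdot>\<^sub>m A + A' + ((B + B') + (C + C'))"
      if "A \<in> carrier_mat n n" "B \<in> carrier_mat n n" "C \<in> carrier_mat n n"
        "A' \<in> carrier_mat n n" "B' \<in> carrier_mat n n" "C' \<in> carrier_mat n n" for A B C A' B' C' :: "complex mat"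
      using that by (intro eq_matI) auto
    from this[OF c(1) d(1,3) c(2) d(2,4)]
    show "\<L> \<rho> + \<K> \<rho> = 1 \<cdot>\<^sub>m \<Psi> \<rho> + \<Psi>' \<rho> + ((G + G') * \<rho> + \<rho> * adj (G + G'))"
      unfolding e f L1 L2 .
    have "\<L> \<rho> \<in> carrier_mat n n" "\<K> \<rho> \<in> carrier_mat n n"
      unfolding L1 L2 by (intro add_carrier_mat c d)+
    from mtrace_add[OF this] show "mtrace (\<L> \<rho> + \<K> \<rho>) = 0"
      using conjunct2[OF bspec[OF 1(3) \<rho>]] conjunct2[OF bspec[OF 2(3) \<rho>]] by simp
  qed
qed

lemma gksl_form_cong:
  assumes "gksl_form n \<L>" "\<And>\<rho>. \<rho> \<in> carrier_mat n n \<Longrightarrow> \<K> \<rho> = \<L> \<rho>"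
  shows "gksl_form n \<K>"
  using assms unfolding gksl_form_def by simp

lemma gksl_form_hamiltonian:
  assumes H: "H \<in> carrier_mat n n" "hermitian_mat H"
  shows "gksl_form n (\<lambda>\<rho>. (- \<i>) \<cdot>\<^sub>m commutator H \<rho>)"
  unfolding gksl_form_def
proof (intro exI conjI ballI)
  show "(- \<i>) \<cdot>\<^sub>m H \<in> carrier_mat n n" using H by simp
  show "cp_map n n (\<lambda>_. 0\<^sub>m n n)" by (rule cp_map_zero)
  fix \<rho> :: "complex mat" assume \<rho>: "\<rho> \<in> carrier_mat n n"
  have "((- \<i>) \<cdot>\<^sub>m H) * \<rho> + \<rho> * adj ((- \<i>) \<cdot>\<^sub>m H) \<in> carrier_mat n n" using H \<rho> by auto
  then show "(- \<i>) \<cdot>\<^sub>m commutator H \<rho> = 0\<^sub>m n n + (((- \<i>) \<cdot>\<^sub>m H) * \<rho> + \<rho> * adj ((- \<i>) \<cdot>\<^sub>m H))"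
    unfolding commutator_split[OF H \<rho>] by simp
  show "mtrace ((- \<i>) \<cdot>\<^sub>m commutator H \<rho>) = 0"
    unfolding commutator_def
    using mtrace_mult_commute[OF H(1) \<rho>] mtrace_diff[OF mult_carrier_mat[OF H(1) \<rho>] mult_carrier_mat[OF \<rho> H(1)]]
      mtrace_smult[OF minus_carrier_mat[OF mult_carrier_mat[OF \<rho> H(1)]]] by simp
qed

lemma gksl_form_dissipator:
  assumes K: "K \<in> carrier_mat n n"
  shows "gksl_form n (\<lambda>\<rho>. K * \<rho> * adj K - (1/2) \<cdot>\<^sub>m anticommutator (adj K * K) \<rho>)"
  unfolding gksl_form_def
proof (intro exI conjI ballI)
  show "(-1/2) \<cdot>\<^sub>m (adj K * K) \<in> carrier_mat n n" using K by auto
  show "cp_map n n (\<lambda>\<rho>. K * \<rho> * adj K)" by (rule cp_map_conj[OF K])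
  fix \<rho> :: "complex mat" assume \<rho>: "\<rho> \<in> carrier_mat n n"
  show "K * \<rho> * adj K - (1/2) \<cdot>\<^sub>m anticommutator (adj K * K) \<rho> =
    K * \<rho> * adj K + (((-1/2) \<cdot>\<^sub>m (adj K * K)) * \<rho> + \<rho> * adj ((-1/2) \<cdot>\<^sub>m (adj K * K)))"
    by (rule dissipator_split[OF K \<rho>])
  have KK: "adj K * K \<in> carrier_mat n n" using K by auto
  have c: "K * \<rho> \<in> carrier_mat n n" "adj K \<in> carrier_mat n n" using K \<rho> by auto
  have "mtrace (K * \<rho> * adj K) = mtrace (adj K * K * \<rho>)"
    using mtrace_mult_commute[OF c] assoc_mult_mat[OF c(2) K \<rho>] by simp
  moreover have "mtrace (\<rho> * (adj K * K)) = mtrace (adj K * K * \<rho>)" by (rule mtrace_mult_commute[OF \<rho> KK])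
  moreover have "mtrace (A - (1/2) \<cdot>\<^sub>m (B + C)) = mtrace A - 1/2 * (mtrace B + mtrace C)"
    if "A \<in> carrier_mat n n" "B \<in> carrier_mat n n" "C \<in> carrier_mat n n" for A B C :: "complex mat"
    using that by (simp add: mtrace_diff[of _ n] mtrace_smult[of _ n] mtrace_add[of _ n])
  note this[OF mult_carrier_mat[OF c] mult_carrier_mat[OF KK \<rho>] mult_carrier_mat[OF \<rho> KK]]
  ultimately show "mtrace (K * \<rho> * adj K - (1/2) \<cdot>\<^sub>m anticommutator (adj K * K) \<rho>) = 0"
    unfolding anticommutator_def by (simp only:) simp
qed

lemma lindblad_generator_gksl_form:
  assumes "lindblad_generator n \<L>"
  shows "gksl_form n \<L>"
proof -
  obtain H Ls where H: "H \<in> carrier_mat n n" "hermitian_mat H" and Ls: "set Ls \<subseteq> carrier_mat n n"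
    and \<L>: "\<forall>\<rho> \<in> carrier_mat n n. \<L> \<rho> = (- \<i>) \<cdot>\<^sub>m commutator H \<rho> +
             foldr (\<lambda>Lu acc. (Lu * \<rho> * adj Lu - (1/2) \<cdot>\<^sub>m anticommutator (adj Lu * Lu) \<rho>) + acc) Ls (0\<^sub>m n n)"
    using assms unfolding lindblad_generator_def by (elim exE conjE)
  have "gksl_form n (\<lambda>\<rho>. foldr (\<lambda>Lu acc. (Lu * \<rho> * adj Lu - (1/2) \<cdot>\<^sub>m anticommutator (adj Lu * Lu) \<rho>) + acc) Ls (0\<^sub>m n n))"
    using Ls
  proof (induction Ls)
    case Nil
    have "adj (0\<^sub>m n n) = 0\<^sub>m n n" by (rule eq_matI) auto
    then have "gksl_form n (\<lambda>\<rho>. 0\<^sub>m n n)" unfolding gksl_form_def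
      by (intro exI[of _ "0\<^sub>m n n"] exI[of _ "\<lambda>_. 0\<^sub>m n n"]) (simp add: cp_map_zero mtrace_def)
    then show ?case by simp
  next
    case (Cons K Ls)
    then have "K \<in> carrier_mat n n" by simp
    from gksl_form_add[OF gksl_form_dissipator[OF this] Cons.IH] Cons.prems show ?case by simp
  qed
  from gksl_form_add[OF gksl_form_hamiltonian[OF H] this] show ?thesis
    by (rule gksl_form_cong) (use \<L> in blast)
qed

lemma lin_map_left_mult:
  assumes "G \<in> carrier_mat n n"
  shows "lin_map n n (\<lambda>\<rho>. G * \<rho>)"
  by (rule lin_mapI) (use assms in \<open>auto simp: mult_add_distrib_mat[of _ n n _ n] mult_smult_distrib[of _ n n _ n]\<close>)

lemma lin_map_right_mult:
  assumes "G \<in> carrier_mat n n"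
  shows "lin_map n n (\<lambda>\<rho>. \<rho> * G)"
  by (rule lin_mapI) (use assms in \<open>auto simp: add_mult_distrib_mat[of _ n n _ _ n] mult_smult_assoc_mat[of _ n n _ n]\<close>)

lemma lin_map_cong:
  assumes "lin_map d d' \<Phi>" "\<And>X. X \<in> carrier_mat d d \<Longrightarrow> \<Psi> X = \<Phi> X"
  shows "lin_map d d' \<Psi>"
  by (rule lin_mapI) (use assms in \<open>auto simp: lin_map_lin intro: lin_map_carrier\<close>)

text \<open>Expanding the conjugation gives the first-order terms of the generator and one
  second-order remainder. The remainder is placed inside the bracket, so that the step reads as the
  identity plus \<epsilon> times a perturbed generator, the form required by
  \<open>qds_on_map_exp\<close>.\<close>

lemma gksl_euler_step:
  assumes G: "G \<in> carrier_mat n n" and \<rho>: "\<rho> \<in> carrier_mat n n" and \<Psi>: "\<Psi> \<in> carrier_mat n n"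
  shows "complex_of_real \<epsilon> \<cdot>\<^sub>m \<Psi> +
      (complex_of_real \<epsilon> \<cdot>\<^sub>m G + 1\<^sub>m n) * \<rho> * adj (complex_of_real \<epsilon> \<cdot>\<^sub>m G + 1\<^sub>m n)
    = complex_of_real \<epsilon> \<cdot>\<^sub>m (\<Psi> + (G * \<rho> + \<rho> * adj G) + complex_of_real \<epsilon> \<cdot>\<^sub>m (G * \<rho> * adj G)) + \<rho>"
proof -
  define e where "e = complex_of_real \<epsilon>"
  have c: "G * \<rho> \<in> carrier_mat n n" "adj G \<in> carrier_mat n n" "\<rho> * adj G \<in> carrier_mat n n"
    "G * \<rho> * adj G \<in> carrier_mat n n" using G \<rho> by auto
  define S where "S = e \<cdot>\<^sub>m (G * \<rho>) + \<rho>"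
  have S: "S \<in> carrier_mat n n" using c \<rho> by (simp add: S_def)
  have 1: "(e \<cdot>\<^sub>m G + 1\<^sub>m n) * \<rho> = S"
    unfolding S_def add_mult_distrib_mat[OF smult_carrier_mat[OF G] one_carrier_mat \<rho>]
      mult_smult_assoc_mat[OF G \<rho>] left_mult_one_mat[OF \<rho>] ..
  have 2: "adj (e \<cdot>\<^sub>m G + 1\<^sub>m n) = e \<cdot>\<^sub>m adj G + 1\<^sub>m n"
    unfolding adj_add[OF smult_carrier_mat[OF G] one_carrier_mat] adj_smult adj_one by (simp add: e_def)
  have 3: "S * (e \<cdot>\<^sub>m adj G + 1\<^sub>m n) = e \<cdot>\<^sub>m (S * adj G) + S"
    unfolding mult_add_distrib_mat[OF S smult_carrier_mat[OF c(2)] one_carrier_mat]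
      mult_smult_distrib[OF S c(2)] right_mult_one_mat[OF S] ..
  have 4: "S * adj G = e \<cdot>\<^sub>m (G * \<rho> * adj G) + \<rho> * adj G"
    unfolding S_def add_mult_distrib_mat[OF smult_carrier_mat[OF c(1)] \<rho> c(2)]
      mult_smult_assoc_mat[OF c(1,2)] ..
  have "e \<cdot>\<^sub>m \<Psi> + (e \<cdot>\<^sub>m (e \<cdot>\<^sub>m C + B) + (e \<cdot>\<^sub>m A + \<rho>)) = e \<cdot>\<^sub>m (\<Psi> + (A + B) + e \<cdot>\<^sub>m C) + \<rho>"
    if "A \<in> carrier_mat n n" "B \<in> carrier_mat n n" "C \<in> carrier_mat n n" for A B C :: "complex mat"
    using that \<rho> \<Psi> by (intro eq_matI) (auto simp: algebra_simps)
  from this[OF c(1,3,4)] show ?thesis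
    unfolding e_def[symmetric] 1 2 3 4 unfolding S_def .
qed

section \<open>The reduction and injection maps\<close>

lemma offset_le:
  assumes "k < length ds"
  shows "offset ds k + ds ! k \<le> sum_list ds"
proof -
  have "offset ds k + ds ! k = sum_list (take (Suc k) ds)"
    using assms by (simp add: offset_def take_Suc_conv_app_nth)
  also have "\<dots> \<le> sum_list (take (Suc k) ds) + sum_list (drop (Suc k) ds)" by simp
  also have "\<dots> = sum_list ds" by (metis append_take_drop_id sum_list_append)
  finally show ?thesis .
qed

lemma offset_0 [simp]: "offset ds 0 = 0"
  by (simp add: offset_def)

lemma offset_Cons_Suc [simp]: "offset (e # ds) (Suc k) = e + offset ds k"
  by (simp add: offset_def)

lemma bdiag_carrier:
  "list_all2 (\<lambda>X e. X \<in> carrier_mat e e) Xs ds \<Longrightarrow> bdiag Xs \<in> carrier_mat (sum_list ds) (sum_list ds)"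
  by (induction Xs ds rule: list_all2_induct) auto

lemma diag_block_bdiag:
  assumes "list_all2 (\<lambda>X e. X \<in> carrier_mat e e) Xs ds" "k < length ds"
  shows "diag_block (offset ds k) (ds ! k) (bdiag Xs) = Xs ! k"
  using assms
proof (induction Xs ds arbitrary: k rule: list_all2_induct)
  case (Cons X Xs e ds)
  note X = carrier_matD[OF Cons.hyps(1)] and B = carrier_matD[OF bdiag_carrier[OF Cons.hyps(2)]]
  show ?case
  proof (cases k)
    case 0
    then show ?thesis by (intro eq_matI) (auto simp: diag_block_def X B)
  next
    case (Suc k')
    then have k': "k' < length ds" using Cons.prems by simp
    have "diag_block (e + offset ds k') (ds ! k') (bdiag (X # Xs)) = diag_block (offset ds k') (ds ! k') (bdiag Xs)"
      using offset_le[OF k'] by (intro eq_matI) (auto simp: diag_block_def X B)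
    then show ?thesis using Suc Cons.IH[OF k'] by simp
  qed
qed simp

lemma mtrace_bdiag:
  "list_all2 (\<lambda>X e. X \<in> carrier_mat e e) Xs ds \<Longrightarrow> mtrace (bdiag Xs) = sum_list (map mtrace Xs)"
proof (induction Xs ds rule: list_all2_induct)
  case (Cons X Xs e ds)
  note [simp] = carrier_matD[OF Cons.hyps(1)] carrier_matD[OF bdiag_carrier[OF Cons.hyps(2)]]
  have "mtrace (bdiag (X # Xs)) = mtrace X + mtrace (bdiag Xs)"
    by (simp add: mtrace_def sum_lessThan_add)
  then show ?case using Cons.IH by simp
qed (simp add: mtrace_def)

lemma sum_blocks:
  fixes h :: "nat \<Rightarrow> 'a::comm_monoid_add"
  shows "(\<Sum>k<length ds. \<Sum>i<ds ! k. h (offset ds k + i)) = (\<Sum>i<sum_list ds. h i)"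
proof (induction ds arbitrary: h)
  case (Cons e ds)
  show ?case
    using Cons.IH[of "\<lambda>i. h (e + i)"]
    by (simp only: length_Cons sum.lessThan_Suc_shift) (simp add: sum_lessThan_add add.assoc)
qed simp

lemma mtrace_ptrace2: "M \<in> carrier_mat (f * g) (f * g) \<Longrightarrow> mtrace (ptrace2 f g M) = mtrace M"
  by (simp add: mtrace_def ptrace2_def sum_lessThan_mult)

text \<open>Unit trace of the second factor is what makes the injection a right inverse of the
  partial trace.\<close>

lemma ptrace2_kron:
  assumes "X \<in> carrier_mat f f" "T \<in> carrier_mat g g" "mtrace T = 1"
  shows "ptrace2 f g (kron X T) = X"
proof (rule eq_matI)
  fix i j assume "i < dim_row X" "j < dim_col X"
  then have ij: "i < f" "j < f" using assms by auto
  have "ptrace2 f g (kron X T) $$ (i,j) = (\<Sum>l<g. X $$ (i,j) * T $$ (l,l))"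
    using assms(1,2) ij by (auto simp: ptrace2_def kron_def offset_less div_mod_offset intro!: sum.cong)
  also have "\<dots> = X $$ (i,j)"
    using assms(2,3) by (simp add: sum_distrib_left[symmetric] mtrace_def)
  finally show "ptrace2 f g (kron X T) $$ (i,j) = X $$ (i,j)" .
qed (use assms in \<open>auto simp: ptrace2_def\<close>)

lemma fdims_nth [simp]: "k < length bl \<Longrightarrow> fdims bl ! k = fst (bl ! k)"
  by (simp add: fdims_def)

lemma fgdims_nth [simp]: "k < length bl \<Longrightarrow> fgdims bl ! k = fst (bl ! k) * snd (bl ! k)"
  by (simp add: fgdims_def case_prod_beta)

lemma length_dims [simp]: "length (fdims bl) = length bl" "length (fgdims bl) = length bl"
  by (simp_all add: fdims_def fgdims_def)

lemma map_fdims: "map (\<lambda>k. fst (bl ! k)) [0..<length bl] = fdims bl"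
  by (rule nth_equalityI) auto

lemma map_fgdims: "map (\<lambda>k. fst (bl ! k) * snd (bl ! k)) [0..<length bl] = fgdims bl"
  by (rule nth_equalityI) auto

lemma list_all2_upt:
  assumes "\<And>k. k < length ds \<Longrightarrow> \<Phi> k \<in> carrier_mat (ds ! k) (ds ! k)" "length ds = m"
  shows "list_all2 (\<lambda>X e. X \<in> carrier_mat e e) (map \<Phi> [0..<m]) ds"
  using assms by (simp add: list_all2_conv_all_nth)

text \<open>\<open>Pk\<close> is a 0/1 matrix selecting consecutive coordinates, so the double sum
  for the conjugation collapses to one entry.\<close>

lemma Pk_conj:
  assumes k: "k < length bl" and Y: "Y \<in> carrier_mat (sum_list (fgdims bl)) (sum_list (fgdims bl))"
  shows "Pk bl k * Y * adj (Pk bl k) = diag_block (offset (fgdims bl) k) (fst (bl ! k) * snd (bl ! k)) Y"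
proof (rule eq_matI)
  let ?n = "sum_list (fgdims bl)" and ?o = "offset (fgdims bl) k" and ?s = "fst (bl ! k) * snd (bl ! k)"
  have P: "Pk bl k \<in> carrier_mat ?s ?n" using k by (simp add: Pk_def)
  have le: "?o + ?s \<le> ?n" using offset_le[of k "fgdims bl"] k by simp
  fix i j assume "i < dim_row (diag_block ?o ?s Y)" "j < dim_col (diag_block ?o ?s Y)"
  then have ij: "i < ?s" "j < ?s" by (auto simp: diag_block_def)
  have "(Pk bl k * Y * adj (Pk bl k)) $$ (i,j) =
      (\<Sum>p<?n. \<Sum>q<?n. Pk bl k $$ (i,p) * Y $$ (p,q) * cnj (Pk bl k $$ (j,q)))"
    by (rule conj_index[OF P Y ij])
  also have "\<dots> = (\<Sum>p<?n. if p = ?o + i then (\<Sum>q<?n. if q = ?o + j then Y $$ (p,q) else 0) else 0)"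
    using ij k by (intro sum.cong refl) (auto simp: Pk_def intro!: sum.cong simp del: sum.delta sum.delta')
  also have "\<dots> = Y $$ (?o + i, ?o + j)" using le ij by simp
  finally show "(Pk bl k * Y * adj (Pk bl k)) $$ (i,j) = diag_block ?o ?s Y $$ (i,j)"
    using ij by (simp add: diag_block_def)
qed (use k in \<open>auto simp: Pk_def diag_block_def\<close>)

lemma diag_block_carrier: "diag_block off s X \<in> carrier_mat s s"
  by (simp add: diag_block_def)

text \<open>No condition on \<open>X\<close> is required, because \<open>ptrace2\<close> fixes the
  size of each block. Invariance of the reduced algebra under any map followed by
  \<open>red_R\<close> is thus immediate.\<close>

lemma red_R_in_red_alg: "red_R bl U X \<in> red_alg bl"
  unfolding red_R_def red_alg_def
  by (intro CollectI exI conjI refl) (auto simp: ptrace2_def)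

text \<open>The second claim says that an element is determined by its diagonal blocks; it is what
  \<open>red_J\<close> followed by \<open>red_R\<close> reconstructs.\<close>

lemma red_alg_elem:
  assumes "X \<in> red_alg bl"
  shows "X \<in> carrier_mat (sum_list (fdims bl)) (sum_list (fdims bl))"
    and "bdiag (map (\<lambda>k. diag_block (offset (fdims bl) k) (fst (bl ! k)) X) [0..<length bl]) = X"
proof -
  obtain Xs where Xs: "X = bdiag Xs" "length Xs = length bl"
    "\<forall>k < length bl. Xs ! k \<in> carrier_mat (fst (bl ! k)) (fst (bl ! k))"
    using assms unfolding red_alg_def by blast
  then have all2: "list_all2 (\<lambda>X e. X \<in> carrier_mat e e) Xs (fdims bl)"
    by (simp add: list_all2_conv_all_nth)
  from bdiag_carrier[OF this] show "X \<in> carrier_mat (sum_list (fdims bl)) (sum_list (fdims bl))" using Xs(1) by simp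
  have "map (\<lambda>k. diag_block (offset (fdims bl) k) (fst (bl ! k)) X) [0..<length bl] = Xs"
    using diag_block_bdiag[OF all2] by (intro nth_equalityI) (auto simp: Xs)
  then show "bdiag (map (\<lambda>k. diag_block (offset (fdims bl) k) (fst (bl ! k)) X) [0..<length bl]) = X"
    using Xs(1) by simp
qed

section \<open>Reduction and injection for a fixed Wedderburn decomposition\<close>

context
  fixes n :: nat and bl :: "(nat \<times> nat) list" and U :: "complex mat" and \<tau> :: "nat \<Rightarrow> complex mat"
  assumes n: "n = sum_list (fgdims bl)"
    and U: "unitary_mat n U"
    and tau: "\<And>k. k < length bl \<Longrightarrow> psd (snd (bl ! k)) (\<tau> k)"
    and tau_trace: "\<And>k. k < length bl \<Longrightarrow> mtrace (\<tau> k) = 1"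
begin

lemma U_carrier: "U \<in> carrier_mat n n" and U_inverse: "adj U * U = 1\<^sub>m n" "U * adj U = 1\<^sub>m n"
  using U by (auto simp: unitary_mat_def)

lemma Pk_carrier: "k < length bl \<Longrightarrow> Pk bl k \<in> carrier_mat (fst (bl ! k) * snd (bl ! k)) n"
  by (simp add: Pk_def n)

lemma Wk_carrier: "k < length bl \<Longrightarrow> Wk bl U k \<in> carrier_mat (fst (bl ! k) * snd (bl ! k)) n"
  unfolding Wk_def using Pk_carrier[of k] U_carrier by auto

lemma Wk_conj:
  assumes k: "k < length bl" and Y: "Y \<in> carrier_mat n n"
  shows "Wk bl U k * Y * adj (Wk bl U k) =
    diag_block (offset (fgdims bl) k) (fst (bl ! k) * snd (bl ! k)) (adj U * Y * U)"
proof -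
  note P = Pk_carrier[OF k] and aU = adj_carrier[OF U_carrier]
  have "adj (Wk bl U k) = U * adj (Pk bl k)"
    unfolding Wk_def using adj_mult[OF P aU] by simp
  moreover have "Wk bl U k * Y * (U * adj (Pk bl k)) = Pk bl k * (adj U * Y * U) * adj (Pk bl k)"
    unfolding Wk_def assoc_mult_mat[OF P aU Y] assoc_mult_mat[OF P mult_carrier_mat[OF aU Y] U_carrier, symmetric]
      assoc_mult_mat[OF mult_carrier_mat[OF P mult_carrier_mat[OF aU Y]] U_carrier adj_carrier[OF P], symmetric] ..
  moreover have "adj U * Y * U \<in> carrier_mat (sum_list (fgdims bl)) (sum_list (fgdims bl))"
    unfolding n[symmetric] by (rule mult_carrier_mat[OF mult_carrier_mat[OF aU Y] U_carrier])
  ultimately show ?thesis using Pk_conj[OF k] by (simp only:)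
qed

lemma cp_map_red_R: "cp_map n (sum_list (fdims bl)) (red_R bl U)"
proof -
  have "cp_map n (sum_list (map (\<lambda>k. fst (bl ! k)) [0..<length bl])) (\<lambda>X. bdiag (map (\<lambda>k.
      ptrace2 (fst (bl ! k)) (snd (bl ! k)) (Wk bl U k * X * adj (Wk bl U k))) [0..<length bl]))"
    by (rule cp_map_bdiag) (auto intro!: cp_map_comp[OF cp_map_conj cp_map_ptrace2] Wk_carrier)
  then show ?thesis unfolding red_R_def[abs_def] map_fdims .
qed

text \<open>Reading off diagonal blocks makes sense for every matrix, so \<open>red_J\<close> is
  completely positive on the whole matrix space and not merely on block diagonal arguments.\<close>

lemma cp_map_red_J: "cp_map (sum_list (fdims bl)) n (red_J bl U \<tau>)"
proof -
  have "cp_map (sum_list (fdims bl)) (sum_list (map (\<lambda>k. fst (bl ! k) * snd (bl ! k)) [0..<length bl])) (\<lambda>X. bdiag (map (\<lambda>k.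
      kron (diag_block (offset (fdims bl) k) (fst (bl ! k)) X) (\<tau> k)) [0..<length bl]))"
  proof (rule cp_map_bdiag)
    fix k assume "k \<in> set [0..<length bl]"
    then have k: "k < length bl" by simp
    show "cp_map (sum_list (fdims bl)) (fst (bl ! k) * snd (bl ! k)) (\<lambda>X. kron (diag_block (offset (fdims bl) k) (fst (bl ! k)) X) (\<tau> k))"
      using offset_le[of k "fdims bl"] k
      by (intro cp_map_comp[OF cp_map_diag_block cp_map_kron] tau) auto
  qed
  from cp_map_comp[OF this[unfolded map_fgdims, folded n] cp_map_conj[OF U_carrier]]
  show ?thesis unfolding red_J_def[abs_def] .
qed

text \<open>The unitaries cancel, each \<open>Wk\<close> reads back its own block, and the partial
  trace removes \<open>\<tau> k\<close> since its trace is 1.\<close>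

lemma red_R_red_J:
  assumes X: "X \<in> red_alg bl"
  shows "red_R bl U (red_J bl U \<tau> X) = X"
proof -
  define Zs where "Zs = map (\<lambda>k. kron (diag_block (offset (fdims bl) k) (fst (bl ! k)) X) (\<tau> k)) [0..<length bl]"
  have tc: "\<tau> k \<in> carrier_mat (snd (bl ! k)) (snd (bl ! k))" if "k < length bl" for k
    using tau[OF that] by (simp add: psd_def)
  have Zs: "list_all2 (\<lambda>X e. X \<in> carrier_mat e e) Zs (fgdims bl)"
    unfolding Zs_def using tc by (intro list_all2_upt) (auto intro!: kron_carrier diag_block_carrier)
  then have Z: "bdiag Zs \<in> carrier_mat n n" using bdiag_carrier n by simp
  have J: "red_J bl U \<tau> X = U * bdiag Zs * adj U" by (simp add: red_J_def Zs_def)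
  have aU: "adj U \<in> carrier_mat n n" using U_carrier by simp
  note Za = mult_carrier_mat[OF Z aU]
  have UZ: "adj U * (U * bdiag Zs * adj U) * U = bdiag Zs"
    unfolding assoc_mult_mat[OF U_carrier Z aU] assoc_mult_mat[OF aU U_carrier Za, symmetric] U_inverse
      left_mult_one_mat[OF Za] assoc_mult_mat[OF Z aU U_carrier] right_mult_one_mat[OF Z] ..
  have "ptrace2 (fst (bl ! k)) (snd (bl ! k)) (Wk bl U k * red_J bl U \<tau> X * adj (Wk bl U k))
      = diag_block (offset (fdims bl) k) (fst (bl ! k)) X" if k: "k < length bl" for k
  proof -
    have "Wk bl U k * red_J bl U \<tau> X * adj (Wk bl U k) =
        diag_block (offset (fgdims bl) k) (fgdims bl ! k) (bdiag Zs)"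
      using Wk_conj[OF k mult_carrier_mat[OF mult_carrier_mat[OF U_carrier Z] aU]] k
      by (simp only: J UZ fgdims_nth)
    also have "\<dots> = Zs ! k" using diag_block_bdiag[OF Zs] k by simp
    finally show ?thesis
      using k by (simp add: Zs_def ptrace2_kron[OF diag_block_carrier tc tau_trace])
  qed
  then have "red_R bl U (red_J bl U \<tau> X) =
      bdiag (map (\<lambda>k. diag_block (offset (fdims bl) k) (fst (bl ! k)) X) [0..<length bl])"
    unfolding red_R_def by (intro arg_cong[of _ _ bdiag]) simp
  then show ?thesis using red_alg_elem(2)[OF X] by simp
qed

text \<open>This provides the linear map \<open>P\<close> that \<open>qds_on_map_exp\<close> asks
  for. One inclusion is \<open>red_R_red_J\<close>; the other holds because every value of
  \<open>red_R\<close> lies in the algebra.\<close>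

lemma red_alg_eq_fixed_points: "red_alg bl = {X \<in> carrier_mat (sum_list (fdims bl)) (sum_list (fdims bl)). red_R bl U (red_J bl U \<tau> X) = X}"
proof (intro Set.set_eqI iffI)
  fix X assume "X \<in> {X \<in> carrier_mat (sum_list (fdims bl)) (sum_list (fdims bl)). red_R bl U (red_J bl U \<tau> X) = X}"
  then have "red_R bl U (red_J bl U \<tau> X) = X" by simp
  then show "X \<in> red_alg bl" by (metis red_R_in_red_alg)
qed (simp add: red_alg_elem(1) red_R_red_J)

text \<open>The blocks tile the diagonal of \<open>adj U * Y * U\<close>, partial traces preserve
  the trace of each block, and cyclicity removes \<open>U\<close>.\<close>

lemma mtrace_red_R:
  assumes Y: "Y \<in> carrier_mat n n"
  shows "mtrace (red_R bl U Y) = mtrace Y"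
proof -
  have aU: "adj U \<in> carrier_mat n n" using U_carrier by simp
  define Z where "Z = adj U * Y * U"
  have Z: "Z \<in> carrier_mat n n" using aU U_carrier Y by (auto simp: Z_def)
  have "mtrace (red_R bl U Y) = sum_list (map mtrace (map (\<lambda>k. ptrace2 (fst (bl ! k)) (snd (bl ! k))
      (Wk bl U k * Y * adj (Wk bl U k))) [0..<length bl]))"
    unfolding red_R_def by (rule mtrace_bdiag[OF list_all2_upt[of "fdims bl"]]) (auto simp: ptrace2_def)
  also have "\<dots> = (\<Sum>k<length bl. mtrace (ptrace2 (fst (bl ! k)) (snd (bl ! k)) (Wk bl U k * Y * adj (Wk bl U k))))"
    by (simp add: interv_sum_list_conv_sum_set_nat o_def lessThan_atLeast0)
  also have "\<dots> = (\<Sum>k<length (fgdims bl). \<Sum>i<fgdims bl ! k. Z $$ (offset (fgdims bl) k + i, offset (fgdims bl) k + i))"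
  proof (intro sum.cong)
    fix k assume "k \<in> {..<length (fgdims bl)}"
    then have k: "k < length bl" by simp
    show "mtrace (ptrace2 (fst (bl ! k)) (snd (bl ! k)) (Wk bl U k * Y * adj (Wk bl U k))) =
        (\<Sum>i<fgdims bl ! k. Z $$ (offset (fgdims bl) k + i, offset (fgdims bl) k + i))"
      unfolding Wk_conj[OF k Y] Z_def[symmetric] mtrace_ptrace2[OF diag_block_carrier]
      using k by (simp add: mtrace_def diag_block_def)
  qed simp
  also have "\<dots> = mtrace Z"
    unfolding sum_blocks[of "\<lambda>i. Z $$ (i,i)"] using carrier_matD[OF Z] by (simp add: mtrace_def n)
  also have "\<dots> = mtrace (U * (adj U * Y))"
    unfolding Z_def by (rule mtrace_mult_commute[OF mult_carrier_mat[OF aU Y] U_carrier])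
  also have "U * (adj U * Y) = Y"
    unfolding assoc_mult_mat[OF U_carrier aU Y, symmetric] U_inverse by (rule left_mult_one_mat[OF Y])
  finally show ?thesis .
qed

lemma qds_on_reduced:
  assumes "lindblad_generator n \<L>"
  shows "qds_on (sum_list (fdims bl)) (red_alg bl) (map_exp (sum_list (fdims bl)) (red_R bl U \<circ> \<L> \<circ> red_J bl U \<tau>))"
proof -
  obtain G \<Psi> where G: "G \<in> carrier_mat n n" and \<Psi>: "cp_map n n \<Psi>"
    and \<L>: "\<forall>\<rho>\<in>carrier_mat n n. \<L> \<rho> = \<Psi> \<rho> + (G * \<rho> + \<rho> * adj G) \<and> mtrace (\<L> \<rho>) = 0"
    using lindblad_generator_gksl_form[OF assms] unfolding gksl_form_def by (elim exE conjE)
  let ?R = "red_R bl U" and ?J = "red_J bl U \<tau>"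
  note R = cp_map_lin[OF cp_map_red_R] and J = cp_map_lin[OF cp_map_red_J]
  have "lin_map n n (\<lambda>\<rho>. \<Psi> \<rho> + (G * \<rho> + \<rho> * adj G))"
    by (intro lin_map_add cp_map_lin[OF \<Psi>] lin_map_left_mult lin_map_right_mult G adj_carrier)
  \<comment> \<open>A generator is prescribed on \<open>carrier_mat n n\<close> only, so linearity
    is transported from the explicit formula there.\<close>
  then have lin\<L>: "lin_map n n \<L>" by (rule lin_map_cong) (use \<L> in blast)
  define N where "N \<epsilon> \<rho> = complex_of_real \<epsilon> \<cdot>\<^sub>m \<Psi> \<rho> +
      (complex_of_real \<epsilon> \<cdot>\<^sub>m G + 1\<^sub>m n) * \<rho> * adj (complex_of_real \<epsilon> \<cdot>\<^sub>m G + 1\<^sub>m n)" for \<epsilon> \<rho>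
  have N: "cp_map n n (N \<epsilon>)" if "\<epsilon> > 0" for \<epsilon>
    unfolding N_def[abs_def] using that G by (intro cp_map_lincomb \<Psi> cp_map_conj) auto
  define Q where "Q = (\<lambda>\<rho>. G * \<rho> * adj G)"
  have Q: "lin_map n n Q" unfolding Q_def by (rule cp_map_lin[OF cp_map_conj[OF G]])
  have N_eq: "N \<epsilon> \<rho> = complex_of_real \<epsilon> \<cdot>\<^sub>m (\<L> \<rho> + complex_of_real \<epsilon> \<cdot>\<^sub>m Q \<rho>) + \<rho>" if "\<rho> \<in> carrier_mat n n" for \<epsilon> \<rho>
    using gksl_euler_step[OF G that lin_map_carrier[OF cp_map_lin[OF \<Psi>] that], of \<epsilon>] bspec[OF \<L> that]
    by (simp add: N_def Q_def)
  show ?thesis unfolding o_def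
  \<comment> \<open>The generator, \<open>P\<close>, \<open>Q\<close> and
    \<open>M \<epsilon>\<close> are the maps \<open>\<L>\<close>, \<open>id\<close>,
    \<open>Q\<close> and \<open>N \<epsilon>\<close> on the large space, each sandwiched between
    \<open>?R\<close> and \<open>?J\<close>. The summand \<open>\<rho>\<close> of the Euler step
    becomes \<open>X\<close> on the algebra, because there \<open>?R (?J X) = X\<close>.\<close>
  proof (rule qds_on_map_exp[OF _ _ _ red_alg_eq_fixed_points])
    show "lin_map (sum_list (fdims bl)) (sum_list (fdims bl)) (\<lambda>X. ?R (\<L> (?J X)))" "lin_map (sum_list (fdims bl)) (sum_list (fdims bl)) (\<lambda>X. ?R (?J X))" "lin_map (sum_list (fdims bl)) (sum_list (fdims bl)) (\<lambda>X. ?R (Q (?J X)))"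
      by (rule lin_map_comp[OF lin_map_comp[OF J lin\<L>] R] lin_map_comp[OF J R]
          lin_map_comp[OF lin_map_comp[OF J Q] R])+
    show "cp_map (sum_list (fdims bl)) (sum_list (fdims bl)) (\<lambda>X. ?R (N \<epsilon> (?J X)))" if "\<epsilon> > 0" for \<epsilon>
      by (rule cp_map_comp[OF cp_map_comp[OF cp_map_red_J N[OF that]] cp_map_red_R])
    fix X assume X: "X \<in> red_alg bl"
    have JX: "?J X \<in> carrier_mat n n" by (rule lin_map_carrier[OF J red_alg_elem(1)[OF X]])
    have c: "\<L> (?J X) \<in> carrier_mat n n" "Q (?J X) \<in> carrier_mat n n"
      using lin_map_carrier[OF lin\<L> JX] lin_map_carrier[OF Q JX] by auto
    show "mtrace (?R (\<L> (?J X))) = 0" using mtrace_red_R[OF c(1)] conjunct2[OF bspec[OF \<L> JX]] by (simp only:)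
    fix \<epsilon> :: real assume "\<epsilon> > 0"
    show "?R (N \<epsilon> (?J X)) = complex_of_real \<epsilon> \<cdot>\<^sub>m (?R (\<L> (?J X)) + complex_of_real \<epsilon> \<cdot>\<^sub>m ?R (Q (?J X))) + X"
      using c JX by (simp add: N_eq lin_map_lin[OF R] lin_map_add_arg[OF R] lin_map_smult_arg[OF R] red_R_red_J[OF X])
  qed (simp_all add: red_R_in_red_alg)
qed

end

theorem theorem4:
  fixes n :: nat and bl :: "(nat \<times> nat) list" and U :: "complex mat"
    and \<tau> :: "nat \<Rightarrow> complex mat" and \<L> :: "complex mat \<Rightarrow> complex mat"
  assumes dims: "\<forall>k < length bl. fst (bl ! k) \<ge> 1 \<and> snd (bl ! k) \<ge> 1"
    and n_def: "n = sum_list (fgdims bl)"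
    and U: "unitary_mat n U"
    and tau: "\<forall>k < length bl. full_rank_density (snd (bl ! k)) (\<tau> k)"
    and L: "lindblad_generator n \<L>"
  shows "(\<forall>X \<in> red_alg bl. (red_R bl U \<circ> \<L> \<circ> red_J bl U \<tau>) X \<in> red_alg bl) \<and>
         qds_on (sum_list (fdims bl)) (red_alg bl)
           (\<lambda>t. map_exp (sum_list (fdims bl)) (red_R bl U \<circ> \<L> \<circ> red_J bl U \<tau>) t)"
proof -
  have "psd (snd (bl ! k)) (\<tau> k)" "mtrace (\<tau> k) = 1" if "k < length bl" for k
    using tau that by (auto simp: full_rank_density_def)
  from qds_on_reduced[OF n_def U this L] show ?thesis
    by (simp add: red_R_in_red_alg)
qed

end
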